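(* Let $\{M, a_{ij}(x), b_i(x), g(x), K(x,y)\}$ be a Finsleroid-regular space, i.e. $M$ is an $N$-dimensional $C^\infty$ manifold with a Riemannian metric $a_{ij}(x)$, a 1-form $b=b_i(x)y^i$ whose Riemannian norm $c(x)=\sqrt{a^{ij}b_ib_j}$ satisfies $0<c(x)<1$ at every point, a scalar field $g(x)$ with $-2<g(x)<2$, and the Finsler metric function $K$ is the one built from these data in the context. Then at every $x\in M$ and every $y\in T_xM\setminus\{0\}$ the spray coefficients $G^i=\gamma^i{}_{nm}y^ny^m$ of $K$ can be written explicitly as $$G^i=\frac{g}{\nu}\Bigl(y^jy^h\nabla_jb_h+g\,q\,b^jf_j\Bigr)v^i-g\,q\,f^i+E^i+a^i{}_{nm}y^ny^m,$$ where $$E^i=M(yg)\,y^i+K\,\frac{2b^2w^2}{gB}\,(yg)\,X A^i-\frac12 M K^2 g_h g^{ih}.$$ All symbols are as defined in the context.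
   Context: Setting. $M$ is an $N$-dimensional $C^\infty$ manifold with local coordinates $x^i$ and tangent vectors $y=(y^i)\in T_xM\setminus\{0\}$; $a_{ij}(x)$ is a Riemannian metric with inverse $a^{ij}$; $b=b_i(x)y^i$ is a 1-form with $a^{ij}b_ib_j=c^2(x)$, $0<c(x)<1$; $g=g(x)$ is a scalar field with $-2<g(x)<2$ (the Finsleroid charge). All data are smooth. Indices of $b_i$ are raised with $a^{ij}$: $b^i=a^{ij}b_j$. The same letter $b$ denotes the value $b_i(x)y^i$, and the same letter $M$ is also used for a scalar function defined below. Metric function. Put $S=\sqrt{a_{ij}y^iy^j}$, $q=\sqrt{S^2-b^2}$ (which is positive for $y\neq0$ because $c<1$), $h=\sqrt{1-g^2/4}$, $G=g/h$ (this $G$, without index, is not a spray coefficient), $L=q+\frac g2 b$, and $$B=b^2+gqb+q^2 .$$ The Finsleroid-regular metric function is $$K(x,y)=\sqrt{B}\,e^{-\frac12 G f},$$ where $f=-\arctan\frac G2+\arctan\frac{L}{hb}$ if $b\ge0$, and $f=\pi-\arctan\frac G2+\arctan\frac{L}{hb}$ if $b\le0$ (at $b=0$ the value is the common limit $f=\frac\pi2-\arctan\frac G2$). Finslerian objects. $y_i=\frac12\,\partial K^2/\partial y^i$; $g_{ij}=\frac12\,\partial^2K^2/\partial y^i\partial y^j$ with inverse $g^{ij}$; $\gamma^i{}_{nm}=\frac12 g^{ij}(\partial_{x^m}g_{jn}+\partial_{x^n}g_{jm}-\partial_{x^j}g_{nm})$ are the Finslerian Christoffel symbols; the spray coefficients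 are $G^i=\gamma^i{}_{nm}y^ny^m$ (no factor $\frac12$). The Cartan tensor is $A_{ijk}=\frac K2\,\partial g_{ij}/\partial y^k$, with $A_i=g^{jk}A_{ijk}$ and $A^i=g^{ij}A_j$. Riemannian objects. $a^k{}_{ij}=\frac12a^{kn}(\partial_ja_{ni}+\partial_ia_{nj}-\partial_na_{ji})$ are the Christoffel symbols of $a_{ij}$, and $\nabla_ib_j=\partial_ib_j-b_ka^k{}_{ij}$. Further $f_{mn}=\nabla_mb_n-\nabla_nb_m=\partial b_n/\partial x^m-\partial b_m/\partial x^n$, $f_j=f_{jn}y^n$, $f^i{}_n=a^{ik}f_{kn}$, $f^i=f^i{}_ny^n$ (distinct from the scalar $f$ in the definition of $K$). Auxiliary quantities. - $\nu=q+(1-c^2)gb$ (positive for $y\ne0$), $v^i=y^i-b\,b^i$, $w=q/b$ (so that $b^2w^2=q^2$). - $X$ is defined by $\frac1X=N+\frac{(1-c^2)B}{q\nu}$. - $g_h=\partial g/\partial x^h$ and $(yg)=g_hy^h$. - The scalar function $M$ is defined by $\partial K/\partial g=\frac12MK$, where $K$ is regarded as a function of $(g,b_i,a_{ij},y)$ and differentiated with respect to $g$ at fixed $b_i,a_{ij},y$. - The expression $\frac1gXA^i$ in $E^i$ is regular also where $g=0$: it is understood after cancellation of the factor $g$ contained in $A^i$, that is $\frac1gXA^i=\frac{1}{2K\nu}\bigl[Bb^i-(b+gqc^2)y^i\bigr]$. *)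

theory Defs
  imports "HOL-Analysis.Analysis"
begin

section \<open>Partial derivatives and smooth functions\<close>

definition pd :: "'n::finite \<Rightarrow> (real^'n \<Rightarrow> real) \<Rightarrow> real^'n \<Rightarrow> real" where
  "pd i f x = deriv (\<lambda>t. f (x + t *\<^sub>R axis i 1)) 0"

text \<open>The following two notions are only meant for open sets \<open>D\<close>.\<close>

primrec Ck_on :: "nat \<Rightarrow> (real^'n::finite) set \<Rightarrow> (real^'n \<Rightarrow> real) \<Rightarrow> bool" where
  "Ck_on 0 D f \<longleftrightarrow> continuous_on D f"
| "Ck_on (Suc k) D f \<longleftrightarrow> f differentiable_on D \<and> (\<forall>i. Ck_on k D (pd i f))"

definition smooth_on :: "(real^'n::finite) set \<Rightarrow> (real^'n \<Rightarrow> real) \<Rightarrow> bool" where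
  "smooth_on D f \<longleftrightarrow> (\<forall>k. Ck_on k D f)"


section \<open>Smooth manifolds and tensor fields in local coordinates\<close>

type_synonym ('m, 'n) chart = "'m set \<times> ('m \<Rightarrow> real^'n)"

abbreviation chart_dom :: "('m, 'n) chart \<Rightarrow> 'm set" where
  "chart_dom \<phi> \<equiv> fst \<phi>"

abbreviation coords :: "('m, 'n) chart \<Rightarrow> 'm \<Rightarrow> real^'n" where
  "coords \<phi> \<equiv> snd \<phi>"

definition chart_image :: "('m, 'n) chart \<Rightarrow> (real^'n) set" where
  "chart_image \<phi> = coords \<phi> ` chart_dom \<phi>"

definition chart_inv :: "('m, 'n) chart \<Rightarrow> real^'n \<Rightarrow> 'm" where
  "chart_inv \<phi> = inv_into (chart_dom \<phi>) (coords \<phi>)"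

definition is_chart :: "('m::topological_space, 'n::finite) chart \<Rightarrow> bool" where
  "is_chart \<phi> \<longleftrightarrow> open (chart_dom \<phi>) \<and> open (chart_image \<phi>) \<and>
     homeomorphism (chart_dom \<phi>) (chart_image \<phi>) (coords \<phi>) (chart_inv \<phi>)"

definition overlap :: "('m, 'n) chart \<Rightarrow> ('m, 'n) chart \<Rightarrow> (real^'n) set" where
  "overlap \<phi> \<psi> = coords \<phi> ` (chart_dom \<phi> \<inter> chart_dom \<psi>)"

definition transition :: "('m, 'n) chart \<Rightarrow> ('m, 'n) chart \<Rightarrow> real^'n \<Rightarrow> real^'n" where
  "transition \<phi> \<psi> x = coords \<psi> (chart_inv \<phi> x)"

definition smooth_atlas :: "('m::topological_space, 'n::finite) chart set \<Rightarrow> bool" where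
  "smooth_atlas \<A> \<longleftrightarrow>
     (\<forall>\<phi>\<in>\<A>. is_chart \<phi>) \<and>
     (\<Union>\<phi>\<in>\<A>. chart_dom \<phi>) = UNIV \<and>
     (\<forall>\<phi>\<in>\<A>. \<forall>\<psi>\<in>\<A>. \<forall>k. smooth_on (overlap \<phi> \<psi>) (\<lambda>x. transition \<phi> \<psi> x $ k))"

text \<open>Tensor fields are given classically: by their components in every chart, as functions of
  the coordinates, subject to the transformation law on overlaps.\<close>

definition local_rep :: "('m, 'n) chart \<Rightarrow> ('m \<Rightarrow> real) \<Rightarrow> real^'n \<Rightarrow> real" where
  "local_rep \<phi> g x = g (chart_inv \<phi> x)"

definition smooth_scalar_field :: "('m, 'n::finite) chart set \<Rightarrow> ('m \<Rightarrow> real) \<Rightarrow> bool" where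
  "smooth_scalar_field \<A> g \<longleftrightarrow> (\<forall>\<phi>\<in>\<A>. smooth_on (chart_image \<phi>) (local_rep \<phi> g))"

definition smooth_one_form ::
    "('m, 'n::finite) chart set \<Rightarrow> (('m, 'n) chart \<Rightarrow> real^'n \<Rightarrow> real^'n) \<Rightarrow> bool" where
  "smooth_one_form \<A> b \<longleftrightarrow>
     (\<forall>\<phi>\<in>\<A>. \<forall>i. smooth_on (chart_image \<phi>) (\<lambda>x. b \<phi> x $ i)) \<and>
     (\<forall>\<phi>\<in>\<A>. \<forall>\<psi>\<in>\<A>. \<forall>x\<in>overlap \<phi> \<psi>. \<forall>i.
        b \<phi> x $ i = (\<Sum>k\<in>UNIV. pd i (\<lambda>z. transition \<phi> \<psi> z $ k) x * b \<psi> (transition \<phi> \<psi> x) $ k))"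

definition riemannian_metric ::
    "('m, 'n::finite) chart set \<Rightarrow> (('m, 'n) chart \<Rightarrow> real^'n \<Rightarrow> real^'n^'n) \<Rightarrow> bool" where
  "riemannian_metric \<A> a \<longleftrightarrow>
     (\<forall>\<phi>\<in>\<A>. \<forall>i j. smooth_on (chart_image \<phi>) (\<lambda>x. a \<phi> x $ i $ j)) \<and>
     (\<forall>\<phi>\<in>\<A>. \<forall>x\<in>chart_image \<phi>. \<forall>i j. a \<phi> x $ i $ j = a \<phi> x $ j $ i) \<and>
     (\<forall>\<phi>\<in>\<A>. \<forall>x\<in>chart_image \<phi>. \<forall>y. y \<noteq> 0 \<longrightarrow>
        (\<Sum>i\<in>UNIV. \<Sum>j\<in>UNIV. a \<phi> x $ i $ j * y $ i * y $ j) > 0) \<and>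
     (\<forall>\<phi>\<in>\<A>. \<forall>\<psi>\<in>\<A>. \<forall>x\<in>overlap \<phi> \<psi>. \<forall>i j.
        a \<phi> x $ i $ j = (\<Sum>k\<in>UNIV. \<Sum>l\<in>UNIV.
          pd i (\<lambda>z. transition \<phi> \<psi> z $ k) x * pd j (\<lambda>z. transition \<phi> \<psi> z $ l) x *
          a \<psi> (transition \<phi> \<psi> x) $ k $ l))"


section \<open>The Finsleroid metric function\<close>

text \<open>In this section \<open>\<gamma>\<close>, \<open>\<beta>\<close>, \<open>\<alpha>\<close> are the values at one point of the charge
  \<open>g\<close>, of the components \<open>b\<^sub>i\<close> and of the components \<open>a\<^sub>i\<^sub>j\<close>.\<close>

definition raise :: "real^'n^'n \<Rightarrow> real^'n \<Rightarrow> real^'n::finite" where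
  "raise \<alpha> \<beta> = (\<chi> i. \<Sum>j\<in>UNIV. matrix_inv \<alpha> $ i $ j * \<beta> $ j)"

definition form_norm :: "real^'n^'n \<Rightarrow> real^'n::finite \<Rightarrow> real" where
  "form_norm \<alpha> \<beta> = sqrt (\<Sum>i\<in>UNIV. \<Sum>j\<in>UNIV. matrix_inv \<alpha> $ i $ j * \<beta> $ i * \<beta> $ j)"

definition fb :: "real^'n \<Rightarrow> real^'n::finite \<Rightarrow> real" where
  "fb \<beta> y = (\<Sum>i\<in>UNIV. \<beta> $ i * y $ i)"

definition fS :: "real^'n^'n \<Rightarrow> real^'n::finite \<Rightarrow> real" where
  "fS \<alpha> y = sqrt (\<Sum>i\<in>UNIV. \<Sum>j\<in>UNIV. \<alpha> $ i $ j * y $ i * y $ j)"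

definition fq :: "real^'n \<Rightarrow> real^'n^'n \<Rightarrow> real^'n::finite \<Rightarrow> real" where
  "fq \<beta> \<alpha> y = sqrt ((fS \<alpha> y)\<^sup>2 - (fb \<beta> y)\<^sup>2)"

definition fh :: "real \<Rightarrow> real" where
  "fh \<gamma> = sqrt (1 - \<gamma>\<^sup>2 / 4)"

definition fG :: "real \<Rightarrow> real" where
  "fG \<gamma> = \<gamma> / fh \<gamma>"

definition fL :: "real \<Rightarrow> real^'n \<Rightarrow> real^'n^'n \<Rightarrow> real^'n::finite \<Rightarrow> real" where
  "fL \<gamma> \<beta> \<alpha> y = fq \<beta> \<alpha> y + \<gamma> / 2 * fb \<beta> y"

definition fB :: "real \<Rightarrow> real^'n \<Rightarrow> real^'n^'n \<Rightarrow> real^'n::finite \<Rightarrow> real" where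
  "fB \<gamma> \<beta> \<alpha> y = (fb \<beta> y)\<^sup>2 + \<gamma> * fq \<beta> \<alpha> y * fb \<beta> y + (fq \<beta> \<alpha> y)\<^sup>2"

text \<open>At \<open>b = 0\<close> the value is the common limit of the two branches.\<close>

definition ff :: "real \<Rightarrow> real^'n \<Rightarrow> real^'n^'n \<Rightarrow> real^'n::finite \<Rightarrow> real" where
  "ff \<gamma> \<beta> \<alpha> y =
     (if fb \<beta> y > 0 then - arctan (fG \<gamma> / 2) + arctan (fL \<gamma> \<beta> \<alpha> y / (fh \<gamma> * fb \<beta> y))
      else if fb \<beta> y < 0 then pi - arctan (fG \<gamma> / 2) + arctan (fL \<gamma> \<beta> \<alpha> y / (fh \<gamma> * fb \<beta> y))
      else pi / 2 - arctan (fG \<gamma> / 2))"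

definition fK :: "real \<Rightarrow> real^'n \<Rightarrow> real^'n^'n \<Rightarrow> real^'n::finite \<Rightarrow> real" where
  "fK \<gamma> \<beta> \<alpha> y = sqrt (fB \<gamma> \<beta> \<alpha> y) * exp (- (1/2) * fG \<gamma> * ff \<gamma> \<beta> \<alpha> y)"

definition fnu :: "real \<Rightarrow> real^'n \<Rightarrow> real^'n^'n \<Rightarrow> real^'n::finite \<Rightarrow> real" where
  "fnu \<gamma> \<beta> \<alpha> y = fq \<beta> \<alpha> y + (1 - (form_norm \<alpha> \<beta>)\<^sup>2) * \<gamma> * fb \<beta> y"

definition fv :: "real^'n \<Rightarrow> real^'n^'n \<Rightarrow> real^'n \<Rightarrow> real^'n::finite" where
  "fv \<beta> \<alpha> y = y - fb \<beta> y *\<^sub>R raise \<alpha> \<beta>"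

definition fX :: "real \<Rightarrow> real^'n \<Rightarrow> real^'n^'n \<Rightarrow> real^'n::finite \<Rightarrow> real" where
  "fX \<gamma> \<beta> \<alpha> y = 1 / (real CARD('n) +
     (1 - (form_norm \<alpha> \<beta>)\<^sup>2) * fB \<gamma> \<beta> \<alpha> y / (fq \<beta> \<alpha> y * fnu \<gamma> \<beta> \<alpha> y))"

text \<open>The scalar \<open>M\<close> with \<open>\<partial>K/\<partial>g = M K / 2\<close>.\<close>

definition fM :: "real \<Rightarrow> real^'n \<Rightarrow> real^'n^'n \<Rightarrow> real^'n::finite \<Rightarrow> real" where
  "fM \<gamma> \<beta> \<alpha> y = 2 * deriv (\<lambda>t. fK t \<beta> \<alpha> y) \<gamma> / fK \<gamma> \<beta> \<alpha> y"

definition K_field :: "(real^'n \<Rightarrow> real) \<Rightarrow> (real^'n \<Rightarrow> real^'n) \<Rightarrow> (real^'n \<Rightarrow> real^'n^'n) \<Rightarrow>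
    real^'n \<Rightarrow> real^'n::finite \<Rightarrow> real" where
  "K_field g b a x y = fK (g x) (b x) (a x) y"


section \<open>Riemannian and Finslerian objects in a chart\<close>

definition christoffel :: "(real^'n \<Rightarrow> real^'n^'n) \<Rightarrow> real^'n::finite \<Rightarrow> 'n \<Rightarrow> 'n \<Rightarrow> 'n \<Rightarrow> real" where
  "christoffel m x k i j = 1/2 * (\<Sum>n\<in>UNIV. matrix_inv (m x) $ k $ n *
     (pd j (\<lambda>z. m z $ n $ i) x + pd i (\<lambda>z. m z $ n $ j) x - pd n (\<lambda>z. m z $ j $ i) x))"

definition fundamental_tensor :: "(real^'n \<Rightarrow> real^'n \<Rightarrow> real) \<Rightarrow> real^'n \<Rightarrow> real^'n \<Rightarrow> real^'n^'n::finite" where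
  "fundamental_tensor F x y = (\<chi> i j. 1/2 * pd i (pd j (\<lambda>z. (F x z)\<^sup>2)) y)"

text \<open>No factor \<open>1/2\<close> in the spray coefficients; the \<open>x\<close>-derivatives in the Finslerian Christoffel
  symbols are taken at fixed \<open>y\<close>.\<close>

definition spray :: "(real^'n \<Rightarrow> real^'n \<Rightarrow> real) \<Rightarrow> real^'n \<Rightarrow> real^'n \<Rightarrow> real^'n::finite" where
  "spray F x y = (\<chi> i. \<Sum>n\<in>UNIV. \<Sum>m\<in>UNIV.
     christoffel (\<lambda>z. fundamental_tensor F z y) x i n m * y $ n * y $ m)"

definition cartan_tensor ::
    "(real^'n \<Rightarrow> real^'n \<Rightarrow> real) \<Rightarrow> real^'n \<Rightarrow> real^'n::finite \<Rightarrow> 'n \<Rightarrow> 'n \<Rightarrow> 'n \<Rightarrow> real" where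
  "cartan_tensor F x y i j k = F x y / 2 * pd k (\<lambda>z. fundamental_tensor F x z $ i $ j) y"

definition cartan_form :: "(real^'n \<Rightarrow> real^'n \<Rightarrow> real) \<Rightarrow> real^'n \<Rightarrow> real^'n \<Rightarrow> real^'n::finite" where
  "cartan_form F x y = (\<chi> i. \<Sum>j\<in>UNIV. \<Sum>k\<in>UNIV.
     matrix_inv (fundamental_tensor F x y) $ j $ k * cartan_tensor F x y i j k)"

definition cartan_vector :: "(real^'n \<Rightarrow> real^'n \<Rightarrow> real) \<Rightarrow> real^'n \<Rightarrow> real^'n \<Rightarrow> real^'n::finite" where
  "cartan_vector F x y = raise (fundamental_tensor F x y) (cartan_form F x y)"

text \<open>\<open>nabla a b x i j\<close> is \<open>\<nabla>\<^sub>i b\<^sub>j\<close>.\<close>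

definition nabla :: "(real^'n \<Rightarrow> real^'n^'n) \<Rightarrow> (real^'n \<Rightarrow> real^'n) \<Rightarrow> real^'n::finite \<Rightarrow> 'n \<Rightarrow> 'n \<Rightarrow> real" where
  "nabla a b x i j = pd i (\<lambda>z. b z $ j) x - (\<Sum>k\<in>UNIV. b x $ k * christoffel a x k i j)"

definition curl :: "(real^'n \<Rightarrow> real^'n^'n) \<Rightarrow> (real^'n \<Rightarrow> real^'n) \<Rightarrow> real^'n::finite \<Rightarrow> 'n \<Rightarrow> 'n \<Rightarrow> real" where
  "curl a b x m n = nabla a b x m n - nabla a b x n m"

definition curl_form ::
    "(real^'n \<Rightarrow> real^'n^'n) \<Rightarrow> (real^'n \<Rightarrow> real^'n) \<Rightarrow> real^'n \<Rightarrow> real^'n \<Rightarrow> real^'n::finite" where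
  "curl_form a b x y = (\<chi> j. \<Sum>n\<in>UNIV. curl a b x j n * y $ n)"

definition curl_vector ::
    "(real^'n \<Rightarrow> real^'n^'n) \<Rightarrow> (real^'n \<Rightarrow> real^'n) \<Rightarrow> real^'n \<Rightarrow> real^'n \<Rightarrow> real^'n::finite" where
  "curl_vector a b x y = (\<chi> i. \<Sum>n\<in>UNIV. (\<Sum>k\<in>UNIV. matrix_inv (a x) $ i $ k * curl a b x k n) * y $ n)"

text \<open>The vector \<open>(1/g) X A\<^sup>i\<close>; where \<open>g = 0\<close> it is the expression that remains after cancelling
  the factor \<open>g\<close> contained in \<open>A\<^sup>i\<close>.\<close>

definition XA_over_g :: "(real^'n \<Rightarrow> real) \<Rightarrow> (real^'n \<Rightarrow> real^'n) \<Rightarrow> (real^'n \<Rightarrow> real^'n^'n) \<Rightarrow>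
    real^'n \<Rightarrow> real^'n \<Rightarrow> real^'n::finite" where
  "XA_over_g g b a x y =
     (if g x \<noteq> 0 then (1 / g x * fX (g x) (b x) (a x) y) *\<^sub>R cartan_vector (K_field g b a) x y
      else (1 / (2 * K_field g b a x y * fnu (g x) (b x) (a x) y)) *\<^sub>R
        (fB (g x) (b x) (a x) y *\<^sub>R raise (a x) (b x) -
         (fb (b x) y + g x * fq (b x) (a x) y * (form_norm (a x) (b x))\<^sup>2) *\<^sub>R y))"

text \<open>\<open>yg\<close> is \<open>(yg) = g\<^sub>h y\<^sup>h\<close>.  The product \<open>b\<^sup>2 w\<^sup>2\<close> with \<open>w = q/b\<close> is written \<open>q\<^sup>2\<close>, which also
  gives the intended value where \<open>b = 0\<close>.\<close>

definition E_vector :: "(real^'n \<Rightarrow> real) \<Rightarrow> (real^'n \<Rightarrow> real^'n) \<Rightarrow> (real^'n \<Rightarrow> real^'n^'n) \<Rightarrow>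
    real^'n \<Rightarrow> real^'n \<Rightarrow> real^'n::finite" where
  "E_vector g b a x y = (\<chi> i.
     let K = K_field g b a x y;
         M = fM (g x) (b x) (a x) y;
         q = fq (b x) (a x) y;
         B = fB (g x) (b x) (a x) y;
         yg = (\<Sum>h\<in>UNIV. pd h g x * y $ h)
     in M * yg * y $ i
        + K * (2 * q\<^sup>2 / B) * yg * XA_over_g g b a x y $ i
        - 1/2 * M * K\<^sup>2 * (\<Sum>h\<in>UNIV. pd h g x * matrix_inv (fundamental_tensor (K_field g b a) x y) $ i $ h))"


section \<open>Finsleroid-regular spaces\<close>

text \<open>The metric function of the space is, in each chart \<open>\<phi>\<close>, the function
  \<open>K_field (local_rep \<phi> g) (b \<phi>) (a \<phi>)\<close> of coordinates and tangent vector components.\<close>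

definition finsleroid_regular_space ::
    "('m::{t2_space, second_countable_topology}, 'n::finite) chart set \<Rightarrow>
     (('m, 'n) chart \<Rightarrow> real^'n \<Rightarrow> real^'n^'n) \<Rightarrow> (('m, 'n) chart \<Rightarrow> real^'n \<Rightarrow> real^'n) \<Rightarrow>
     ('m \<Rightarrow> real) \<Rightarrow> bool" where
  "finsleroid_regular_space \<A> a b g \<longleftrightarrow>
     smooth_atlas \<A> \<and> riemannian_metric \<A> a \<and> smooth_one_form \<A> b \<and> smooth_scalar_field \<A> g \<and>
     (\<forall>\<phi>\<in>\<A>. \<forall>x\<in>chart_image \<phi>. 0 < form_norm (a \<phi> x) (b \<phi> x) \<and> form_norm (a \<phi> x) (b \<phi> x) < 1) \<and>
     (\<forall>p. - 2 < g p \<and> g p < 2)"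

end

theory Submission
  imports Defs
begin

text \<open>Everything rests on one closed form. Write \<open>S\<^sup>2 = b\<^sup>2 + q\<^sup>2\<close>, \<open>u\<^sub>i = a\<^sub>i\<^sub>j y\<^sup>j\<close>
  and \<open>P = K\<^sup>2 / B\<close>. Up to a summand depending only on
  \<open>g\<close>, the angle in \<open>K\<close> is the polar angle of the point \<open>(h b, L)\<close>, whose
  squared distance from the origin is \<open>B\<close>; hence along any curve
  \<open>d(K\<^sup>2/2) = P ((b + g q) db + q dq) + M K\<^sup>2/2 dg\<close> (\<open>DERIV_sqK\<close>), where neither the arctangents nor
  a case distinction on the sign of \<open>b\<close> survives, except inside \<open>M\<close>.

  Differentiation in \<open>y\<close> gives \<open>y\<^sub>i = P (g q b\<^sub>i + u\<^sub>i)\<close>. A second differentiation shows that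
  \<open>g\<^sub>i\<^sub>j\<close> is \<open>P a\<^sub>i\<^sub>j\<close> plus a quadratic form in \<open>b\<^sub>i\<close> and \<open>u\<^sub>i\<close> (\<open>fundamental_tensor_eq\<close>), and a third
  one that the Cartan tensor is
  \<open>g P / (q B)\<close> times \<open>K/2 ((e\<^sub>i h\<^sub>j\<^sub>k + e\<^sub>j h\<^sub>i\<^sub>k + e\<^sub>k h\<^sub>i\<^sub>j) / P - e\<^sub>i e\<^sub>j e\<^sub>k / (q\<^sup>2 B))\<close> with
  \<open>e\<^sub>i = S\<^sup>2 b\<^sub>i - b u\<^sub>i\<close> and the angular metric \<open>h\<^sub>i\<^sub>j = g\<^sub>i\<^sub>j - y\<^sub>i y\<^sub>j / K\<^sup>2\<close> (\<open>DERIV_metric\<close>). Its trace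
  needs no formula for \<open>g\<^sup>i\<^sup>j\<close>, only that \<open>g\<^sub>i\<^sub>j\<close> maps the vector \<open>B b\<^sup>i - (b + g q c\<^sup>2) y\<^sup>i\<close> to
  \<open>P \<nu> / q\<close> times \<open>e\<^sub>i\<close>; the same fact yields the invertibility of \<open>g\<^sub>i\<^sub>j\<close>
  (\<open>metric_trivial_kernel\<close>) and the regular expression for \<open>X A\<^sup>i / g\<close> (\<open>XA_over_g_eq\<close>).

  By Euler's identities \<open>g\<^sub>i\<^sub>j G\<^sup>j = y\<^sup>k \<partial>\<^sub>k y\<^sub>i - \<partial>\<^sub>i K\<^sup>2 / 2\<close> (\<open>contracted_christoffel\<close>), with derivatives in
  \<open>x\<close> at fixed \<open>y\<close>. The formula for \<open>y\<^sub>i\<close> makes the right-hand side explicit, and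
  since \<open>g\<^sub>i\<^sub>j\<close> is invertible it remains to lower the index of the claimed expression and compare
  (\<open>lowered_spray\<close>, \<open>spray_formula\<close>). The first derivatives of \<open>a\<^sub>i\<^sub>j\<close> and \<open>b\<^sub>i\<close> enter only through the
  Riemannian spray \<open>\<Gamma>\<^sup>i = a\<^sup>i\<^sub>n\<^sub>m y\<^sup>n y\<^sup>m\<close>, the curl \<open>f\<^sub>i\<close> and \<open>y\<^sup>j y\<^sup>h \<nabla>\<^sub>j b\<^sub>h\<close>, because
  \<open>y\<^sup>k \<partial>\<^sub>k b = y\<^sup>j y\<^sup>h \<nabla>\<^sub>j b\<^sub>h + b\<^sub>k \<Gamma>\<^sup>k\<close>, \<open>y\<^sup>k \<partial>\<^sub>k S\<^sup>2 = 2 u\<^sub>k \<Gamma>\<^sup>k\<close> and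
  \<open>y\<^sup>k \<partial>\<^sub>k b\<^sub>i = \<partial>\<^sub>i b - f\<^sub>i\<close>.\<close>

section \<open>Partial derivatives\<close>

lemma pd_eqI:
  assumes "((\<lambda>t. f (x + t *\<^sub>R axis i 1)) has_real_derivative d) (at 0)"
  shows "pd i f x = d"
  using assms unfolding pd_def by (rule DERIV_imp_deriv)

lemma eventually_axis_in_open:
  fixes x :: "real^'n::finite"
  assumes "open D" "x \<in> D"
  shows "eventually (\<lambda>t::real. x + t *\<^sub>R axis i 1 \<in> D) (nhds 0)"
proof -
  have "((\<lambda>t::real. x + t *\<^sub>R axis i 1) \<longlongrightarrow> x + 0 *\<^sub>R axis i 1) (nhds 0)"
    by (intro tendsto_intros filterlim_ident)
  then show ?thesis using assms by (auto dest: topological_tendstoD)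
qed

lemma DERIV_axis_cong:
  fixes x :: "real^'n::finite"
  assumes "open D" "x \<in> D" "\<And>z. z \<in> D \<Longrightarrow> f z = h z"
    and "((\<lambda>t. h (x + t *\<^sub>R axis i 1)) has_real_derivative d) (at 0)"
  shows "((\<lambda>t. f (x + t *\<^sub>R axis i 1)) has_real_derivative d) (at 0)"
proof -
  have "eventually (\<lambda>t. f (x + t *\<^sub>R axis i 1) = h (x + t *\<^sub>R axis i 1)) (nhds 0)"
    using eventually_axis_in_open[OF assms(1,2)] by eventually_elim (rule assms(3))
  from DERIV_cong_ev[OF refl this refl] show ?thesis using assms(4) by simp
qed

lemma DERIV_pd:
  fixes x :: "real^'n::finite"
  assumes "f differentiable_on D" "open D" "x \<in> D"
  shows "((\<lambda>t. f (x + t *\<^sub>R axis i 1)) has_real_derivative pd i f x) (at 0)"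
proof -
  have "f differentiable (at (x + 0 *\<^sub>R axis i 1))"
    using assms by (simp add: differentiable_on_eq_differentiable_at)
  moreover have "(\<lambda>t::real. x + t *\<^sub>R axis i 1) differentiable (at 0)"
    by (intro derivative_intros)
  ultimately have "(f \<circ> (\<lambda>t. x + t *\<^sub>R axis i 1)) differentiable (at 0)"
    by (intro differentiable_chain_at)
  then have "(\<lambda>t. f (x + t *\<^sub>R axis i 1)) field_differentiable (at 0)"
    by (simp add: o_def field_differentiable_def real_differentiable_def)
  then show ?thesis unfolding pd_def by (rule field_differentiable_derivI)
qed

lemma DERIV_pdI:
  assumes "((\<lambda>t. f (x + t *\<^sub>R axis k 1)) has_real_derivative d) (at 0)"
  shows "((\<lambda>t. f (x + t *\<^sub>R axis k 1)) has_real_derivative pd k f x) (at 0)"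
  using assms pd_eqI[OF assms] by simp

lemma pd_eqI_on_open:
  assumes "open D" "x \<in> D" "\<And>z. z \<in> D \<Longrightarrow> f z = h z"
    and "((\<lambda>t. h (x + t *\<^sub>R axis i 1)) has_real_derivative d) (at 0)"
  shows "pd i f x = d"
  by (rule pd_eqI[OF DERIV_axis_cong[OF assms]])

lemma pd_eq_on_open:
  assumes "open D" "x \<in> D" "\<And>z. z \<in> D \<Longrightarrow> f z = h z"
  shows "pd i f x = pd i h x"
proof -
  have "eventually (\<lambda>t. f (x + t *\<^sub>R axis i 1) = h (x + t *\<^sub>R axis i 1)) (nhds 0)"
    using eventually_axis_in_open[OF assms(1,2)] by eventually_elim (rule assms(3))
  then show ?thesis unfolding pd_def by (rule deriv_cong_ev) simp
qed

section \<open>Contracted Christoffel symbols\<close>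

text \<open>Contracting twice with \<open>y\<close> turns the Christoffel symbols of any matrix field \<open>m\<close> into derivatives of
  the covector \<open>m y\<close> and of the quadratic form \<open>y \<bullet> m y\<close>. No symmetry of \<open>m\<close> is assumed. For
  the fundamental tensor of a metric function \<open>F\<close> at fixed \<open>y\<close> these two are \<open>y\<^sub>i\<close> and \<open>F\<^sup>2\<close>.\<close>

lemma contracted_christoffel:
  fixes m :: "real^'n \<Rightarrow> real^'n::finite^'n" and x y :: "real^'n"
  assumes d: "\<And>i j k. ((\<lambda>t. m (x + t *\<^sub>R axis k 1) $ i $ j) has_real_derivative pd k (\<lambda>z. m z $ i $ j) x) (at 0)"
  shows "(\<Sum>n\<in>UNIV. \<Sum>l\<in>UNIV. christoffel m x i n l * y $ n * y $ l)
    = (matrix_inv (m x) *v (\<chi> j. (\<Sum>k\<in>UNIV. y $ k * pd k (\<lambda>z. (m z *v y) $ j) x)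
          - 1/2 * pd j (\<lambda>z. y \<bullet> (m z *v y)) x)) $ i"
proof -
  have 1: "pd k (\<lambda>z. (m z *v y) $ j) x = (\<Sum>n\<in>UNIV. pd k (\<lambda>z. m z $ j $ n) x * y $ n)" for j k
    unfolding matrix_vector_mult_def
    by (rule pd_eqI) (auto intro!: derivative_eq_intros d)
  have 2: "pd j (\<lambda>z. y \<bullet> (m z *v y)) x
     = (\<Sum>n\<in>UNIV. \<Sum>l\<in>UNIV. pd j (\<lambda>z. m z $ n $ l) x * y $ l * y $ n)" for j
    unfolding matrix_vector_mult_def inner_vec_def
    by (rule pd_eqI) (auto intro!: derivative_eq_intros d sum.cong simp: sum_distrib_left mult.commute)
  let ?p = "\<lambda>k i j. pd k (\<lambda>z. m z $ i $ j) x"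
  \<comment> \<open>The first two terms of the Christoffel symbol agree after exchanging the summation indices.\<close>
  have 3: "(\<Sum>n\<in>UNIV. \<Sum>l\<in>UNIV. (?p l j n + ?p n j l - ?p j l n) * y $ n * y $ l)
      = 2 * (\<Sum>k\<in>UNIV. y $ k * (\<Sum>n\<in>UNIV. ?p k j n * y $ n))
        - (\<Sum>n\<in>UNIV. \<Sum>l\<in>UNIV. ?p j n l * y $ l * y $ n)" for j
  proof -
    have "(\<Sum>n\<in>UNIV. \<Sum>l\<in>UNIV. ?p l j n * y $ n * y $ l)
      = (\<Sum>k\<in>UNIV. y $ k * (\<Sum>n\<in>UNIV. ?p k j n * y $ n))"
      by (subst sum.swap) (simp add: sum_distrib_left mult_ac)
    moreover have "(\<Sum>n\<in>UNIV. \<Sum>l\<in>UNIV. ?p n j l * y $ n * y $ l)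
      = (\<Sum>k\<in>UNIV. y $ k * (\<Sum>n\<in>UNIV. ?p k j n * y $ n))"
      by (simp add: sum_distrib_left mult_ac)
    moreover have "(\<Sum>n\<in>UNIV. \<Sum>l\<in>UNIV. ?p j l n * y $ n * y $ l)
      = (\<Sum>n\<in>UNIV. \<Sum>l\<in>UNIV. ?p j n l * y $ l * y $ n)"
      by (rule sum.swap)
    ultimately show ?thesis
      by (simp add: sum.distrib sum_subtractf algebra_simps)
  qed
  have "(\<Sum>n\<in>UNIV. \<Sum>l\<in>UNIV. christoffel m x i n l * y $ n * y $ l)
     = (\<Sum>n\<in>UNIV. \<Sum>l\<in>UNIV. \<Sum>j\<in>UNIV. matrix_inv (m x) $ i $ j *
          (1/2 * ((?p l j n + ?p n j l - ?p j l n) * y $ n * y $ l)))"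
    unfolding christoffel_def
    by (simp add: sum_distrib_left sum_distrib_right mult_ac)
  also have "\<dots> = (\<Sum>j\<in>UNIV. matrix_inv (m x) $ i $ j *
          (1/2 * (\<Sum>n\<in>UNIV. \<Sum>l\<in>UNIV. (?p l j n + ?p n j l - ?p j l n) * y $ n * y $ l)))"
    unfolding sum_distrib_left
    by (subst (2) sum.swap, subst sum.swap, rule refl)
  finally show ?thesis
    unfolding 3 1 2 by (simp add: matrix_vector_mult_def algebra_simps)
qed

section \<open>Inverses and traces of symmetric matrices\<close>

lemma symmetric_matrix_inner:
  fixes A :: "real^'n::finite^'n"
  assumes "\<And>i j. A $ i $ j = A $ j $ i"
  shows "x \<bullet> (A *v y) = y \<bullet> (A *v x)"
proof -
  have "transpose A = A" using assms by (simp add: transpose_def vec_eq_iff)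
  then show ?thesis by (metis dot_lmul_matrix inner_commute transpose_matrix_vector)
qed

lemma matrix_inv_of_trivial_kernel:
  fixes A :: "real^'n::finite^'n"
  assumes "\<And>x. A *v x = 0 \<Longrightarrow> x = 0"
  shows "A ** matrix_inv A = mat 1" "matrix_inv A ** A = mat 1"
proof -
  have "invertible A" using assms by (metis invertible_left_inverse matrix_left_invertible_ker)
  then have "\<exists>A'. A ** A' = mat 1 \<and> A' ** A = mat 1" by (simp add: invertible_def)
  from someI_ex[OF this] show "A ** matrix_inv A = mat 1" "matrix_inv A ** A = mat 1"
    by (simp_all add: matrix_inv_def)
qed

lemma raise_eq: "raise m \<beta> = matrix_inv m *v \<beta>"
  by (simp add: raise_def matrix_vector_mult_def)

lemma sum_matrix_inner:
  fixes A :: "real^'n::finite^'n"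
  shows "(\<Sum>j\<in>UNIV. \<Sum>k\<in>UNIV. A $ j $ k * (x $ j * w $ k)) = x \<bullet> (A *v w)"
  by (simp add: inner_vec_def matrix_vector_mult_def sum_distrib_left mult_ac)

text \<open>The trace, with respect to \<open>G\<close>, of a symmetric cubic form of the shape that the Cartan tensor has.
  The term \<open>real CARD('n) + 2\<close> collects the three contractions of \<open>e G\<close>.\<close>

lemma trace_of_cubic_form:
  fixes G H :: "real^'n::finite^'n" and e l :: "real^'n"
  assumes sym: "\<And>i j. G $ i $ j = G $ j $ i" and inv: "H ** G = mat 1" "G ** H = mat 1"
  shows "(\<Sum>j\<in>UNIV. \<Sum>k\<in>UNIV. H $ j $ k *
     (e $ i * (G $ j $ k - l $ j * l $ k / s) + e $ j * (G $ i $ k - l $ i * l $ k / s)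
       + e $ k * (G $ i $ j - l $ i * l $ j / s) - t * (e $ i * e $ j * e $ k)))
    = e $ i * (real CARD('n) + 2 - l \<bullet> (H *v l) / s - t * (e \<bullet> (H *v e)))
      - l $ i * (e \<bullet> (H *v l) + l \<bullet> (H *v e)) / s"
proof -
  have 1: "(\<Sum>j\<in>UNIV. \<Sum>k\<in>UNIV. H $ j $ k * G $ j $ k) = real CARD('n)"
  proof -
    have "(\<Sum>k\<in>UNIV. H $ j $ k * G $ j $ k) = 1" for j
      using arg_cong[OF inv(1), of "\<lambda>M. M $ j $ j"] sym by (simp add: matrix_matrix_mult_def mat_def)
    then show ?thesis by simp
  qed
  have 2: "(\<Sum>j\<in>UNIV. \<Sum>k\<in>UNIV. H $ j $ k * (e $ j * G $ i $ k)) = e $ i"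
  proof -
    have "(\<Sum>k\<in>UNIV. H $ j $ k * (e $ j * G $ i $ k)) = (if j = i then e $ j else 0)" for j
    proof -
      have "(\<Sum>k\<in>UNIV. H $ j $ k * (e $ j * G $ i $ k)) = e $ j * (H ** G) $ j $ i"
        by (simp add: matrix_matrix_mult_def sum_distrib_left sym[of i] mult_ac)
      then show ?thesis by (simp add: inv mat_def)
    qed
    then show ?thesis by simp
  qed
  have 3: "(\<Sum>j\<in>UNIV. \<Sum>k\<in>UNIV. H $ j $ k * (e $ k * G $ i $ j)) = e $ i"
  proof -
    have "(\<Sum>j\<in>UNIV. \<Sum>k\<in>UNIV. H $ j $ k * (e $ k * G $ i $ j)) = (G *v (H *v e)) $ i"
      by (simp add: matrix_vector_mult_def sum_distrib_left mult_ac)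
    then show ?thesis by (simp add: matrix_vector_mul_assoc inv)
  qed
  have "(\<Sum>j\<in>UNIV. \<Sum>k\<in>UNIV. H $ j $ k *
     (e $ i * (G $ j $ k - l $ j * l $ k / s) + e $ j * (G $ i $ k - l $ i * l $ k / s)
       + e $ k * (G $ i $ j - l $ i * l $ j / s) - t * (e $ i * e $ j * e $ k)))
    = (\<Sum>j\<in>UNIV. \<Sum>k\<in>UNIV. e $ i * (H $ j $ k * G $ j $ k) - e $ i / s * (H $ j $ k * (l $ j * l $ k))
       + H $ j $ k * (e $ j * G $ i $ k) - l $ i / s * (H $ j $ k * (e $ j * l $ k))
       + H $ j $ k * (e $ k * G $ i $ j) - l $ i / s * (H $ j $ k * (l $ j * e $ k))
       - t * e $ i * (H $ j $ k * (e $ j * e $ k)))"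
    by (intro sum.cong refl) (simp add: algebra_simps diff_divide_distrib add_divide_distrib)
  also have "\<dots> = e $ i * real CARD('n) - e $ i / s * (l \<bullet> (H *v l)) + e $ i - l $ i / s * (e \<bullet> (H *v l))
       + e $ i - l $ i / s * (l \<bullet> (H *v e)) - t * e $ i * (e \<bullet> (H *v e))"
    unfolding sum.distrib sum_subtractf sum_distrib_left[symmetric] 1 2 3 sum_matrix_inner ..
  also have "\<dots> = e $ i * (real CARD('n) + 2 - l \<bullet> (H *v l) / s - t * (e \<bullet> (H *v e)))
      - l $ i * (e \<bullet> (H *v l) + l \<bullet> (H *v e)) / s"
    by (simp add: algebra_simps diff_divide_distrib add_divide_distrib)
  finally show ?thesis .
qed

section \<open>Differentials of the metric function\<close>

text \<open>For \<open>q > 0\<close>, the polar angle of the point \<open>(h b, L)\<close>, normalised to lie between \<open>-\<pi>/2\<close> and \<open>3 \<pi>/2\<close>; it is the angle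
  \<open>f\<close> of the metric function without the constant \<open>- arctan (G/2)\<close>. The arguments are the charge \<open>\<gamma>\<close>
  and the values of \<open>b\<close> and \<open>q\<close>, so that it can be differentiated along an arbitrary curve in these
  three numbers.\<close>

definition finsleroid_angle :: "real \<Rightarrow> real \<Rightarrow> real \<Rightarrow> real" where
  "finsleroid_angle \<gamma> b q =
     (if b > 0 then arctan ((q + \<gamma> / 2 * b) / (fh \<gamma> * b))
      else if b < 0 then pi + arctan ((q + \<gamma> / 2 * b) / (fh \<gamma> * b))
      else pi / 2)"

lemma fh_pos: "\<bar>\<gamma>\<bar> < 2 \<Longrightarrow> fh \<gamma> > 0"
proof -
  assume "\<bar>\<gamma>\<bar> < 2"
  then have "\<bar>\<gamma>\<bar>\<^sup>2 < 2\<^sup>2" by (intro power_strict_mono) auto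
  then show ?thesis by (simp add: fh_def)
qed

lemma fh_square: "\<bar>\<gamma>\<bar> < 2 \<Longrightarrow> (fh \<gamma>)\<^sup>2 = 1 - \<gamma>\<^sup>2 / 4"
  using fh_pos[of \<gamma>] by (simp add: fh_def)

text \<open>A single formula on the half-plane \<open>L > 0\<close>, which contains a neighbourhood of every point with \<open>b = 0\<close> and
  \<open>q > 0\<close>.\<close>

lemma finsleroid_angle_eq:
  assumes "\<bar>\<gamma>\<bar> < 2" "q + \<gamma> / 2 * b > 0"
  shows "finsleroid_angle \<gamma> b q = pi / 2 - arctan (fh \<gamma> * b / (q + \<gamma> / 2 * b))"
proof (cases "b = 0")
  case False
  have h: "fh \<gamma> > 0" using assms fh_pos by auto
  have "fh \<gamma> * b / (q + \<gamma> / 2 * b) \<noteq> 0" using h assms False by simp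
  from Transcendental.arctan_inverse[OF this]
  have "arctan (1 / (fh \<gamma> * b / (q + \<gamma> / 2 * b)))
      = sgn (fh \<gamma> * b / (q + \<gamma> / 2 * b)) * pi / 2 - arctan (fh \<gamma> * b / (q + \<gamma> / 2 * b))"
    by simp
  moreover have "sgn (fh \<gamma> * b / (q + \<gamma> / 2 * b)) = sgn b" using h assms by (simp add: sgn_mult sgn_divide)
  ultimately show ?thesis using False by (auto simp: finsleroid_angle_def sgn_if split: if_splits)
qed (simp add: finsleroid_angle_def)

lemma finsleroid_form_pos:
  fixes \<gamma> b q :: real
  assumes "\<bar>\<gamma>\<bar> < 2" "q > 0"
  shows "b\<^sup>2 + \<gamma> * q * b + q\<^sup>2 > 0"
proof -
  have "b\<^sup>2 + \<gamma> * q * b + q\<^sup>2 = (b + \<gamma> / 2 * q)\<^sup>2 + (fh \<gamma>)\<^sup>2 * q\<^sup>2"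
    unfolding fh_square[OF assms(1)] by (simp add: power2_eq_square field_simps)
  also have "\<dots> > 0" using fh_pos[OF assms(1)] assms(2) by (intro add_nonneg_pos) auto
  finally show ?thesis .
qed

lemma finsleroid_form_eq:
  assumes "\<bar>\<gamma>\<bar> < 2"
  shows "(fh \<gamma> * b)\<^sup>2 + (q + \<gamma> / 2 * b)\<^sup>2 = b\<^sup>2 + \<gamma> * q * b + q\<^sup>2"
  unfolding power_mult_distrib fh_square[OF assms] by (simp add: power2_eq_square field_simps)

lemma DERIV_fh:
  assumes "(g has_real_derivative g') (at t)" "\<bar>g t\<bar> < 2"
  shows "((\<lambda>t. fh (g t)) has_real_derivative - (g t * g') / (4 * fh (g t))) (at t)"
proof -
  have "1 - (g t)\<^sup>2 / 4 > 0" using fh_square[OF assms(2)] fh_pos[OF assms(2)] by (metis zero_less_power)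
  then show ?thesis unfolding fh_def
    by (auto intro!: derivative_eq_intros assms(1) simp: divide_simps power2_eq_square)
qed

lemma DERIV_fG:
  assumes "(g has_real_derivative g') (at t)" "\<bar>g t\<bar> < 2"
  shows "((\<lambda>t. fG (g t)) has_real_derivative g' / fh (g t) ^ 3) (at t)"
proof -
  have h: "fh (g t) > 0" "(g t)\<^sup>2 = 4 - 4 * (fh (g t))\<^sup>2"
    using fh_pos fh_square assms(2) by auto
  have "g' * fh (g t) - g t * (- (g t * g') / (4 * fh (g t))) = g' / fh (g t)"
    using h(1) arg_cong[OF h(2), of "\<lambda>s. g' * s"]
    by (simp add: field_simps power2_eq_square)
  then show ?thesis
    unfolding fG_def using h(1)
    by (auto intro!: derivative_eq_intros DERIV_fh assms simp: power3_eq_cube)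
qed

lemma DERIV_arctan_quotient:
  fixes X Y :: "real \<Rightarrow> real"
  assumes "(Y has_real_derivative Y') (at t)" "(X has_real_derivative X') (at t)" "X t \<noteq> 0"
  shows "((\<lambda>t. arctan (Y t / X t)) has_real_derivative
    (X t * Y' - Y t * X') / ((X t)\<^sup>2 + (Y t)\<^sup>2)) (at t)"
proof -
  have "((X t)\<^sup>2 + (Y t)\<^sup>2) \<noteq> 0" using assms(3) by (simp add: sum_power2_eq_zero_iff)
  moreover have "1 + (Y t / X t)\<^sup>2 = ((X t)\<^sup>2 + (Y t)\<^sup>2) / (X t)\<^sup>2"
    using assms(3) by (simp add: field_simps)
  ultimately have "inverse (1 + (Y t / X t)\<^sup>2) * ((Y' * X t - Y t * X') / (X t * X t))
      = (X t * Y' - Y t * X') / ((X t)\<^sup>2 + (Y t)\<^sup>2)"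
    using assms(3) by (simp add: power2_eq_square mult.commute)
  then show ?thesis
    using DERIV_chain2[OF DERIV_arctan DERIV_divide[OF assms]] by simp
qed

lemma isCont_eventually_greater:
  fixes f :: "real \<Rightarrow> real"
  assumes "isCont f t" "f t > a"
  shows "eventually (\<lambda>s. f s > a) (nhds t)"
  using assms order_tendstoD(1)[of f "f t" "nhds t" a]
  by (simp add: continuous_at tendsto_at_iff_tendsto_nhds)

text \<open>The differential of a polar angle, \<open>(X dY - Y dX) / (X\<^sup>2 + Y\<^sup>2)\<close> for \<open>(X, Y) = (h b, L)\<close>, is the same in
  all three branches; its denominator is the quadratic form \<open>B\<close> by \<open>finsleroid_form_eq\<close>.\<close>

lemma DERIV_finsleroid_angle:
  assumes g: "(g has_real_derivative g') (at t)" and b: "(b has_real_derivative b') (at t)"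
    and q: "(q has_real_derivative q') (at t)" and "\<bar>g t\<bar> < 2" "q t > 0"
  shows "((\<lambda>t. finsleroid_angle (g t) (b t) (q t)) has_real_derivative
     (fh (g t) * (b t * q' - q t * b') + g' * b t * (2 * b t + g t * q t) / (4 * fh (g t)))
       / ((b t)\<^sup>2 + g t * q t * b t + (q t)\<^sup>2)) (at t)"
proof -
  define h where "h = fh (g t)"
  have h: "h > 0" "h\<^sup>2 = 1 - (g t)\<^sup>2 / 4" using fh_pos fh_square assms(4) by (auto simp: h_def)
  let ?L = "\<lambda>t. q t + g t / 2 * b t" and ?H = "\<lambda>t. fh (g t) * b t"
  define L' where "L' = q' + (g' / 2 * b t + g t / 2 * b')"
  define H' where "H' = - (g t * g') / (4 * fh (g t)) * b t + fh (g t) * b'"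
  have L: "(?L has_real_derivative L') (at t)" unfolding L'_def
    by (auto intro!: derivative_eq_intros g b q)
  have H: "(?H has_real_derivative H') (at t)" unfolding H'_def
    by (auto intro!: derivative_eq_intros g b q DERIV_fh assms)
  have cont: "isCont g t" "isCont b t" "isCont q t" "isCont ?L t"
    using g b q L DERIV_isCont by blast+
  have *: "(?H t * L' - ?L t * H') = 
     (fh (g t) * (b t * q' - q t * b') + g' * b t * (2 * b t + g t * q t) / (4 * fh (g t)))"
  proof -
    have "4 * h * (h * b t * L' - ?L t * H')
       = 4 * h\<^sup>2 * (b t * q' - q t * b') + (2 * h\<^sup>2 + (g t)\<^sup>2 / 2) * g' * (b t)\<^sup>2 + g' * b t * g t * q t"
      unfolding L'_def H'_def h_def[symmetric] using h(1)
      by (simp add: field_simps power2_eq_square)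
    also have "2 * h\<^sup>2 + (g t)\<^sup>2 / 2 = 2" using h(2) by simp
    finally show ?thesis using h(1) unfolding h_def[symmetric]
      by (simp add: field_simps power2_eq_square)
  qed
  have BB: "(?H t)\<^sup>2 + (?L t)\<^sup>2 = (b t)\<^sup>2 + g t * q t * b t + (q t)\<^sup>2"
    using finsleroid_form_eq[OF assms(4)] by simp
  have at: "((\<lambda>t. arctan (?L t / ?H t)) has_real_derivative (?H t * L' - ?L t * H') / ((?H t)\<^sup>2 + (?L t)\<^sup>2)) (at t)"
    if "b t \<noteq> 0"
    by (rule DERIV_arctan_quotient[OF L H]) (use that h(1) in \<open>simp add: h_def\<close>)
  consider "b t > 0" | "b t < 0" | "b t = 0" by linarith
  then show ?thesis
  proof cases
    case 1
    have "eventually (\<lambda>s. b s > 0) (nhds t)"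
      by (rule isCont_eventually_greater[OF cont(2) 1])
    then have ev: "eventually (\<lambda>s. finsleroid_angle (g s) (b s) (q s) = arctan (?L s / ?H s)) (nhds t)"
      by eventually_elim (simp add: finsleroid_angle_def)
    have "b t \<noteq> 0" using 1 by simp
    from iffD2[OF DERIV_cong_ev[OF refl ev refl] at[OF this]] show ?thesis unfolding * BB .
  next
    case 2
    have "eventually (\<lambda>s. b s < 0) (nhds t)"
      using isCont_eventually_greater[where f = "\<lambda>s. - b s" and t = t and a = 0] cont(2) 2 by simp
    then have ev: "eventually (\<lambda>s. finsleroid_angle (g s) (b s) (q s) = pi + arctan (?L s / ?H s)) (nhds t)"
      by eventually_elim (simp add: finsleroid_angle_def)
    have "b t \<noteq> 0" using 2 by simp
    from iffD2[OF DERIV_cong_ev[OF refl ev refl] DERIV_add[OF DERIV_const at[OF this]]]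
    show ?thesis unfolding * BB add_0_left .
  next
    case 3
    have nz: "?L t \<noteq> 0" "?L t > 0" using assms(5) 3 by auto
    have "eventually (\<lambda>s. ?L s > 0) (nhds t)"
      by (rule isCont_eventually_greater[OF cont(4) nz(2)])
    moreover have "eventually (\<lambda>s. \<bar>g s\<bar> < 2) (nhds t)"
      using isCont_eventually_greater[where f = "\<lambda>s. - \<bar>g s\<bar>" and t = t and a = "-2"] continuous_rabs[OF cont(1)] assms(4) by simp
    ultimately have ev: "eventually (\<lambda>s. finsleroid_angle (g s) (b s) (q s) = pi / 2 - arctan (?H s / ?L s)) (nhds t)"
      by eventually_elim (simp add: finsleroid_angle_eq)
    have "((\<lambda>t. arctan (?H t / ?L t)) has_real_derivative (?L t * H' - ?H t * L') / ((?L t)\<^sup>2 + (?H t)\<^sup>2)) (at t)"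
      by (rule DERIV_arctan_quotient[OF H L nz(1)])
    then have "((\<lambda>t. pi / 2 - arctan (?H t / ?L t)) has_real_derivative 0 - (?L t * H' - ?H t * L') / ((?L t)\<^sup>2 + (?H t)\<^sup>2)) (at t)"
      by (intro DERIV_diff DERIV_const)
    moreover have "0 - (?L t * H' - ?H t * L') / ((?L t)\<^sup>2 + (?H t)\<^sup>2) = (?H t * L' - ?L t * H') / ((?H t)\<^sup>2 + (?L t)\<^sup>2)"
      by (simp add: add.commute minus_divide_left)
    ultimately have "((\<lambda>t. pi / 2 - arctan (?H t / ?L t)) has_real_derivative
       (?H t * L' - ?L t * H') / ((?H t)\<^sup>2 + (?L t)\<^sup>2)) (at t)" by (rule DERIV_cong)
    from iffD2[OF DERIV_cong_ev[OF refl ev refl] this] show ?thesis unfolding * BB .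
  qed
qed

text \<open>The function \<open>K\<^sup>2\<close> of the charge and of the values of \<open>b\<close> and \<open>q\<close>.\<close>

definition sqK :: "real \<Rightarrow> real \<Rightarrow> real \<Rightarrow> real" where
  "sqK \<gamma> b q = (b\<^sup>2 + \<gamma> * q * b + q\<^sup>2) * exp (- fG \<gamma> * (finsleroid_angle \<gamma> b q - arctan (fG \<gamma> / 2)))"

text \<open>The logarithmic derivative of \<open>K\<^sup>2\<close> in the charge, which is the scalar \<open>M\<close> (see \<open>fM_eq\<close>). Its
  value is never used, only that \<open>K\<^sup>2\<close> has a total differential with this coefficient.\<close>

definition charge_deriv :: "real \<Rightarrow> real \<Rightarrow> real \<Rightarrow> real" where
  "charge_deriv \<gamma> b q =
     q * b / (b\<^sup>2 + \<gamma> * q * b + q\<^sup>2) - (finsleroid_angle \<gamma> b q - arctan (fG \<gamma> / 2)) / fh \<gamma> ^ 3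
     - fG \<gamma> * (b * (2 * b + \<gamma> * q) / (4 * fh \<gamma>) / (b\<^sup>2 + \<gamma> * q * b + q\<^sup>2)) + fG \<gamma> / (2 * fh \<gamma>)"

lemma sqK_pos: "\<bar>\<gamma>\<bar> < 2 \<Longrightarrow> q > 0 \<Longrightarrow> sqK \<gamma> b q > 0"
  unfolding sqK_def by (intro mult_pos_pos finsleroid_form_pos) auto

text \<open>The total differential of \<open>K\<^sup>2\<close>. The factor \<open>G\<close> in the exponent cancels the \<open>h\<close> in the differential of
  the angle, as \<open>G h = g\<close>.\<close>

lemma DERIV_sqK:
  assumes g: "(g has_real_derivative g') (at t)" and b: "(b has_real_derivative b') (at t)"
    and q: "(q has_real_derivative q') (at t)" and "\<bar>g t\<bar> < 2" "q t > 0"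
  shows "((\<lambda>t. sqK (g t) (b t) (q t)) has_real_derivative
     2 * (sqK (g t) (b t) (q t) / ((b t)\<^sup>2 + g t * q t * b t + (q t)\<^sup>2)) * ((b t + g t * q t) * b' + q t * q')
     + charge_deriv (g t) (b t) (q t) * sqK (g t) (b t) (q t) * g') (at t)"
proof -
  define h where "h = fh (g t)"
  define G where "G = fG (g t)"
  define \<psi> where "\<psi> = finsleroid_angle (g t) (b t) (q t) - arctan (G / 2)"
  define B where "B = (b t)\<^sup>2 + g t * q t * b t + (q t)\<^sup>2"
  define N where "N = b t * (2 * b t + g t * q t) / (4 * h)"
  define B' where "B' = 2 * b t * b' + ((g' * q t + q' * g t) * b t + b' * (g t * q t)) + 2 * q t * q'"
  define W' where "W' = - (g' / h ^ 3 * \<psi> + ((h * (b t * q' - q t * b') + g' * N) / B - g' / h ^ 3 / 2 / (1 + (G / 2)\<^sup>2)) * G)"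
  have h: "h > 0" "h\<^sup>2 = 1 - (g t)\<^sup>2 / 4" "G * h = g t" "B > 0"
    using fh_pos[OF assms(4)] fh_square[OF assms(4)] finsleroid_form_pos[OF assms(4,5)] by (auto simp: h_def G_def fG_def B_def)
  have dB: "((\<lambda>t. (b t)\<^sup>2 + g t * q t * b t + (q t)\<^sup>2) has_real_derivative B') (at t)"
    unfolding B'_def by (auto intro!: derivative_eq_intros assms simp: algebra_simps)
  have dat: "((\<lambda>t. arctan (fG (g t) / 2)) has_real_derivative g' / h ^ 3 / 2 / (1 + (G / 2)\<^sup>2)) (at t)"
    unfolding G_def h_def
    by (rule DERIV_cong[OF DERIV_chain2[OF DERIV_arctan DERIV_cdivide[OF DERIV_fG[OF g assms(4)]]]])
      (rule trans[OF mult.commute divide_inverse[symmetric]])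
  have da: "((\<lambda>t. finsleroid_angle (g t) (b t) (q t)) has_real_derivative (h * (b t * q' - q t * b') + g' * N) / B) (at t)"
    by (rule DERIV_cong[OF DERIV_finsleroid_angle[OF g b q assms(4,5)]]) (simp add: h_def N_def B_def)
  have "((\<lambda>t. fG (g t) * (finsleroid_angle (g t) (b t) (q t) - arctan (fG (g t) / 2))) has_real_derivative - W') (at t)"
    using DERIV_mult[OF DERIV_fG[OF g assms(4)] DERIV_diff[OF da dat]]
    by (simp add: W'_def \<psi>_def G_def h_def add.commute)
  from DERIV_minus[OF this]
  have "((\<lambda>t. - fG (g t) * (finsleroid_angle (g t) (b t) (q t) - arctan (fG (g t) / 2))) has_real_derivative W') (at t)"
    by simp
  from DERIV_mult[OF dB DERIV_fun_exp[OF this]]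
  have d: "((\<lambda>t. sqK (g t) (b t) (q t)) has_real_derivative (B' + B * W') * exp (- G * \<psi>)) (at t)"
    by (simp add: sqK_def B_def \<psi>_def G_def algebra_simps)
  have "1 + (G / 2)\<^sup>2 = 1 / h\<^sup>2"
  proof -
    have "4 + G\<^sup>2 = 4 / h\<^sup>2" using h(2) unfolding h(3)[symmetric] using h(1) by (simp add: field_simps)
    then show ?thesis by (simp add: field_simps)
  qed
  then have 1: "g' / h ^ 3 / 2 / (1 + (G / 2)\<^sup>2) = g' / (2 * h)"
    using h(1) by (simp add: power2_eq_square power3_eq_cube)
  have "B * W' = - B * g' / h ^ 3 * \<psi> - (G * h * (b t * q' - q t * b') + G * g' * N) + B * G * g' / (2 * h)"
    unfolding W'_def 1 using h(1,4) by (simp add: field_simps)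
  moreover have m: "charge_deriv (g t) (b t) (q t) * B = q t * b t - B * \<psi> / h ^ 3 - G * N + B * G / (2 * h)"
    unfolding charge_deriv_def B_def[symmetric] G_def[symmetric] \<psi>_def[symmetric] h_def[symmetric] N_def[symmetric]
    using h(4) by (simp add: field_simps)
  then have "charge_deriv (g t) (b t) (q t) * B * g' = g' * q t * b t - B * g' / h ^ 3 * \<psi> - G * g' * N + B * G * g' / (2 * h)"
    by (subst m) (simp add: algebra_simps)
  ultimately have "B' + B * W' = 2 * ((b t + g t * q t) * b' + q t * q') + charge_deriv (g t) (b t) (q t) * B * g'"
    unfolding h(3) by (simp add: B'_def algebra_simps)
  moreover have "sqK (g t) (b t) (q t) = B * exp (- G * \<psi>)"
    by (simp add: sqK_def B_def \<psi>_def G_def)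
  ultimately have e: "(B' + B * W') * exp (- G * \<psi>) = 
     2 * (sqK (g t) (b t) (q t) / B) * ((b t + g t * q t) * b' + q t * q')
     + charge_deriv (g t) (b t) (q t) * sqK (g t) (b t) (q t) * g'"
    using h(4) by (simp add: algebra_simps)
  show ?thesis using d unfolding e unfolding B_def .
qed

lemma fK_square:
  assumes "\<bar>\<gamma>\<bar> < 2" "fq \<beta> \<alpha> y > 0"
  shows "(fK \<gamma> \<beta> \<alpha> y)\<^sup>2 = sqK \<gamma> (fb \<beta> y) (fq \<beta> \<alpha> y)"
proof -
  have B: "fB \<gamma> \<beta> \<alpha> y > 0" unfolding fB_def by (rule finsleroid_form_pos[OF assms])
  have f: "ff \<gamma> \<beta> \<alpha> y = finsleroid_angle \<gamma> (fb \<beta> y) (fq \<beta> \<alpha> y) - arctan (fG \<gamma> / 2)"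
    by (simp add: ff_def finsleroid_angle_def fL_def)
  have "(exp (- (1/2) * fG \<gamma> * ff \<gamma> \<beta> \<alpha> y))\<^sup>2 = exp (- fG \<gamma> * ff \<gamma> \<beta> \<alpha> y)"
    by (simp add: exp_double[symmetric])
  then show ?thesis using B
    unfolding fK_def sqK_def power_mult_distrib f by (simp add: fB_def)
qed

lemma fK_pos:
  assumes "\<bar>\<gamma>\<bar> < 2" "fq \<beta> \<alpha> y > 0"
  shows "fK \<gamma> \<beta> \<alpha> y > 0"
  unfolding fK_def fB_def using finsleroid_form_pos[OF assms] by simp

lemma fM_eq:
  assumes "\<bar>\<gamma>\<bar> < 2" "fq \<beta> \<alpha> y > 0"
  shows "fM \<gamma> \<beta> \<alpha> y = charge_deriv \<gamma> (fb \<beta> y) (fq \<beta> \<alpha> y)"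
proof -
  let ?S = "\<lambda>t. sqK t (fb \<beta> y) (fq \<beta> \<alpha> y)" and ?m = "charge_deriv \<gamma> (fb \<beta> y) (fq \<beta> \<alpha> y)"
  have "(?S has_real_derivative ?m * ?S \<gamma>) (at \<gamma>)"
    by (rule DERIV_cong[OF DERIV_sqK[OF DERIV_ident DERIV_const DERIV_const]]) (use assms in auto)
  from DERIV_chain2[OF DERIV_real_sqrt[OF sqK_pos[OF assms]] this]
  have d: "((\<lambda>t. sqrt (?S t)) has_real_derivative inverse (sqrt (?S \<gamma>)) / 2 * (?m * ?S \<gamma>)) (at \<gamma>)" .
  have "eventually (\<lambda>t. t \<in> {-2<..<2}) (nhds \<gamma>)" using assms(1) by (intro eventually_nhds_in_open) auto
  then have ev: "eventually (\<lambda>t. fK t \<beta> \<alpha> y = sqrt (?S t)) (nhds \<gamma>)"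
  proof eventually_elim
    case (elim t)
    then have "\<bar>t\<bar> < 2" by auto
    then show ?case
      using fK_square[OF _ assms(2), of t] fK_pos[OF _ assms(2), of t] by (metis less_imp_le real_sqrt_unique)
  qed
  have "((\<lambda>t. fK t \<beta> \<alpha> y) has_real_derivative inverse (sqrt (?S \<gamma>)) / 2 * (?m * ?S \<gamma>)) (at \<gamma>)"
    using d by (subst DERIV_cong_ev[OF refl ev refl])
  then have "deriv (\<lambda>t. fK t \<beta> \<alpha> y) \<gamma> = inverse (sqrt (?S \<gamma>)) / 2 * (?m * ?S \<gamma>)" by (rule DERIV_imp_deriv)
  moreover have "sqrt (?S \<gamma>) = fK \<gamma> \<beta> \<alpha> y" "?S \<gamma> = (fK \<gamma> \<beta> \<alpha> y)\<^sup>2"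
    using fK_square[OF assms] fK_pos[OF assms] by (auto simp: real_sqrt_unique)
  ultimately show ?thesis using fK_pos[OF assms] by (simp add: fM_def power2_eq_square field_simps)
qed

text \<open>The conformal factor \<open>P = K\<^sup>2 / B\<close>.\<close>

definition sqK_over_B :: "real \<Rightarrow> real \<Rightarrow> real \<Rightarrow> real" where
  "sqK_over_B \<gamma> b q = sqK \<gamma> b q / (b\<^sup>2 + \<gamma> * q * b + q\<^sup>2)"

lemma sqK_over_B_pos: "\<bar>\<gamma>\<bar> < 2 \<Longrightarrow> q > 0 \<Longrightarrow> sqK_over_B \<gamma> b q > 0"
  by (simp add: sqK_over_B_def sqK_pos finsleroid_form_pos)

lemma sqK_eq: "\<bar>\<gamma>\<bar> < 2 \<Longrightarrow> q > 0 \<Longrightarrow> sqK \<gamma> b q = sqK_over_B \<gamma> b q * (b\<^sup>2 + \<gamma> * q * b + q\<^sup>2)"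
  using finsleroid_form_pos[of \<gamma> q b] by (simp add: sqK_over_B_def)

lemma DERIV_sqK_over_B:
  assumes g: "(g has_real_derivative g') (at t)" and b: "(b has_real_derivative b') (at t)"
    and q: "(q has_real_derivative q') (at t)" and "\<bar>g t\<bar> < 2" "q t > 0"
  shows "((\<lambda>t. sqK_over_B (g t) (b t) (q t)) has_real_derivative
     sqK_over_B (g t) (b t) (q t) *
       (g t / ((b t)\<^sup>2 + g t * q t * b t + (q t)\<^sup>2) * (q t * b' - b t * q')
        + (charge_deriv (g t) (b t) (q t) - q t * b t / ((b t)\<^sup>2 + g t * q t * b t + (q t)\<^sup>2)) * g')) (at t)"
proof -
  define B where "B = (b t)\<^sup>2 + g t * q t * b t + (q t)\<^sup>2"
  define B' where "B' = 2 * b t * b' + ((g' * q t + q' * g t) * b t + b' * (g t * q t)) + 2 * q t * q'"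
  define P where "P = sqK_over_B (g t) (b t) (q t)"
  define m where "m = charge_deriv (g t) (b t) (q t)"
  have B: "B > 0" using finsleroid_form_pos[OF assms(4,5)] by (simp add: B_def)
  have K: "sqK (g t) (b t) (q t) = P * B" using sqK_eq[OF assms(4,5)] by (simp add: P_def B_def)
  have dB: "((\<lambda>t. (b t)\<^sup>2 + g t * q t * b t + (q t)\<^sup>2) has_real_derivative B') (at t)"
    unfolding B'_def by (auto intro!: derivative_eq_intros assms simp: algebra_simps)
  have e: "((2 * P * ((b t + g t * q t) * b' + q t * q') + m * (P * B) * g') * B - P * B * B') / (B * B)
     = P * (g t / B * (q t * b' - b t * q') + (m - q t * b t / B) * g')"
  proof -
    have "2 * ((b t + g t * q t) * b' + q t * q') - B' = g t * (q t * b' - b t * q') - q t * b t * g'"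
      by (simp add: B'_def algebra_simps)
    moreover have "(2 * P * ((b t + g t * q t) * b' + q t * q') + m * (P * B) * g') * B - P * B * B'
      = P * B * (2 * ((b t + g t * q t) * b' + q t * q') - B' + m * B * g')"
      by (simp add: algebra_simps)
    ultimately have "(2 * P * ((b t + g t * q t) * b' + q t * q') + m * (P * B) * g') * B - P * B * B'
      = P * B * (g t * (q t * b' - b t * q') - q t * b t * g' + m * B * g')"
      by simp
    then show ?thesis using B by (simp add: field_simps)
  qed
  have "((\<lambda>t. sqK_over_B (g t) (b t) (q t)) has_real_derivative
     ((2 * P * ((b t + g t * q t) * b' + q t * q') + m * (P * B) * g') * B - P * B * B') / (B * B)) (at t)"
    unfolding sqK_over_B_def
    by (rule DERIV_cong[OF DERIV_divide[OF DERIV_sqK[OF assms] dB]])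
      (use B K in \<open>auto simp: B_def[symmetric] m_def\<close>)
  then show ?thesis unfolding e by (simp add: P_def m_def B_def)
qed

section \<open>Rational identities for the second and third derivatives\<close>

text \<open>For \<open>y\<^sub>j = P (\<gamma> q b\<^sub>j + u\<^sub>j)\<close> and the derivatives \<open>P (\<gamma>/B) (q b\<^sub>i - b q\<^sub>i)\<close> of \<open>P\<close> and \<open>q\<^sub>i = (u\<^sub>i - b b\<^sub>i) / q\<close>
  of \<open>q\<close>, the left-hand side is \<open>\<partial>y\<^sub>j/\<partial>y\<^sup>i\<close> divided by \<open>P\<close>, with \<open>a\<close> standing for \<open>a\<^sub>i\<^sub>j\<close>. The right-hand
  side is manifestly symmetric in \<open>i\<close> and \<open>j\<close>.\<close>

lemma second_derivative_identity:
  fixes \<gamma> b q S B :: real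
  assumes "q \<noteq> 0" "B \<noteq> 0" "S = b\<^sup>2 + q\<^sup>2" "B = b\<^sup>2 + \<gamma> * q * b + q\<^sup>2"
  shows "\<gamma> / B * (q * bi - b * ((ui - b * bi) / q)) * (\<gamma> * q * bj + uj) + (\<gamma> * ((ui - b * bi) / q) * bj + a)
     = a + \<gamma> / (q * B) * ((\<gamma> * q * S - b * B) * bi * bj - b * ui * uj + S * (bi * uj + ui * bj))"
proof -
  have "\<gamma> * (q * (q * bi) - b * (ui - b * bi)) * (\<gamma> * q * bj + uj) + \<gamma> * (ui - b * bi) * bj * B
    = \<gamma> * ((\<gamma> * q * S - b * B) * bi * bj - b * ui * uj + S * (bi * uj + ui * bj))"
    unfolding assms(3,4) by (simp add: algebra_simps power2_eq_square)
  moreover have "\<gamma> / B * (q * bi - b * ((ui - b * bi) / q)) * (\<gamma> * q * bj + uj) + \<gamma> * ((ui - b * bi) / q) * bj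
    = (\<gamma> * (q * (q * bi) - b * (ui - b * bi)) * (\<gamma> * q * bj + uj) + \<gamma> * (ui - b * bi) * bj * B) / (q * B)"
    using assms(1,2) by (simp add: field_simps)
  ultimately have "\<gamma> / B * (q * bi - b * ((ui - b * bi) / q)) * (\<gamma> * q * bj + uj) + \<gamma> * ((ui - b * bi) / q) * bj
    = \<gamma> / (q * B) * ((\<gamma> * q * S - b * B) * bi * bj - b * ui * uj + S * (bi * uj + ui * bj))"
    by simp
  then show ?thesis by linarith
qed

text \<open>The left-hand side is \<open>\<partial>g\<^sub>i\<^sub>j/\<partial>y\<^sup>k\<close> divided by \<open>P\<close>; primes denote \<open>\<partial>/\<partial>y\<^sup>k\<close>. On the right \<open>h\<^sub>i\<^sub>j\<close> is the
  angular metric divided by \<open>P\<close>. That this shape is possible is forced by homogeneity: modulo terms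
  with \<open>a\<^sub>i\<^sub>j\<close>, the totally symmetric tensor \<open>\<partial>g\<^sub>i\<^sub>j/\<partial>y\<^sup>k\<close> is a cubic form in \<open>b\<^sub>i\<close> and \<open>u\<^sub>i\<close>, and \<open>e\<^sub>i\<close> spans
  the combinations of these two that annihilate \<open>y\<close>.\<close>

lemma third_derivative_identity:
  fixes \<gamma> b q S B :: real
  assumes "q \<noteq> 0" "B \<noteq> 0" "S = b\<^sup>2 + q\<^sup>2" "B = b\<^sup>2 + \<gamma> * q * b + q\<^sup>2"
    and qk: "q' = (uk - b * bk) / q"
    and B': "B' = 2 * b * bk + \<gamma> * (q' * b + q * bk) + 2 * q * q'"
    and T: "T = (\<gamma> * q * S - b * B) * bi * bj - b * ui * uj + S * (bi * uj + ui * bj)"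
    and T': "T' = (\<gamma> * (q' * S + q * (2 * uk)) - (bk * B + b * B')) * bi * bj - (bk * ui * uj + b * (aik * uj + ui * ajk))
         + (2 * uk * (bi * uj + ui * bj) + S * (bi * ajk + aik * bj))"
    and e: "ei = S * bi - b * ui" "ej = S * bj - b * uj" "ek = S * bk - b * uk"
    and h: "hjk = ajk - (\<gamma> * b * S * bj * bk - \<gamma> * b\<^sup>2 * (bj * uk + uj * bk) + (\<gamma> * b + q) * uj * uk) / (q * B)"
       "hik = aik - (\<gamma> * b * S * bi * bk - \<gamma> * b\<^sup>2 * (bi * uk + ui * bk) + (\<gamma> * b + q) * ui * uk) / (q * B)"
       "hij = aij - (\<gamma> * b * S * bi * bj - \<gamma> * b\<^sup>2 * (bi * uj + ui * bj) + (\<gamma> * b + q) * ui * uj) / (q * B)"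
  shows "\<gamma> / B * (q * bk - b * q') * (aij + \<gamma> / (q * B) * T)
       + (\<gamma> * (T' * (q * B) - T * (q' * B + q * B')) / ((q * B) * (q * B)))
     = \<gamma> / (q * B) * (ei * hjk + ej * hik + ek * hij - ei * ej * ek / (q\<^sup>2 * B))"
proof -
  have q'q: "q' * q = uk - b * bk" using assms(1) qk by simp
  have ek: "q * (q * bk - b * q') = ek" using q'q unfolding e assms(3) by algebra
  define H where "H = (\<lambda>bi bj ui uj. \<gamma> * b * S * bi * bj - \<gamma> * b\<^sup>2 * (bi * uj + ui * bj) + (\<gamma> * b + q) * ui * uj)"
  \<comment> \<open>The quantities \<open>U\<close> and \<open>V\<close> are \<open>T'\<close> and \<open>B'\<close> cleared of the denominator \<open>q\<close>.\<close>
  define V where "V = q * q * B'"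
  have V: "V = 2 * b * bk * q\<^sup>2 + \<gamma> * (q * (uk - b * bk) * b + q^3 * bk) + 2 * q\<^sup>2 * (uk - b * bk)"
    unfolding V_def B' using q'q by algebra
  define U where "U = (\<gamma> * (q * (uk - b * bk) * S + q^3 * (2 * uk)) - (bk * B * q\<^sup>2 + b * V)) * bi * bj - q\<^sup>2 * (bk * ui * uj + b * (aik * uj + ui * ajk))
         + q\<^sup>2 * (2 * uk * (bi * uj + ui * bj) + S * (bi * ajk + aik * bj))"
  have U: "U = q\<^sup>2 * T'" unfolding U_def T' V_def using q'q by algebra
  have main: "ek * (q * B * aij + \<gamma> * T) * q + (U * B - T * ((uk - b * bk) * B + V))
    = q * (ei * (q * B * ajk - H bj bk uj uk) + ej * (q * B * aik - H bi bk ui uk) + ek * (q * B * aij - H bi bj ui uj)) - ei * ej * ek"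
    unfolding U_def V T e H_def assms(3,4) by algebra
  have 1: "q * B * ajk - H bj bk uj uk = q * B * hjk" "q * B * aik - H bi bk ui uk = q * B * hik"
    "q * B * aij - H bi bj ui uj = q * B * hij"
    unfolding h H_def using assms(1,2) by (simp_all add: field_simps)
  have "\<gamma> / B * (q * bk - b * q') * (aij + \<gamma> / (q * B) * T)
       + (\<gamma> * (T' * (q * B) - T * (q' * B + q * B')) / ((q * B) * (q * B)))
     = \<gamma> / (q^3 * B\<^sup>2) * (q * (q * bk - b * q') * (q * B * aij + \<gamma> * T) * q
         + (q\<^sup>2 * T' * B - T * (q' * q * B + V)))"
    using assms(1,2) by (simp add: V_def field_simps power2_eq_square power3_eq_cube)
  also have "\<dots> = \<gamma> / (q^3 * B\<^sup>2) * (ek * (q * B * aij + \<gamma> * T) * q + (U * B - T * ((uk - b * bk) * B + V)))"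
    unfolding ek U q'q ..
  also have "\<dots> = \<gamma> / (q^3 * B\<^sup>2) * (q * (ei * (q * B * hjk) + ej * (q * B * hik) + ek * (q * B * hij)) - ei * ej * ek)"
    unfolding main 1 ..
  also have "\<dots> = \<gamma> / (q * B) * (ei * hjk + ej * hik + ek * hij - ei * ej * ek / (q\<^sup>2 * B))"
    using assms(1,2) by (simp add: field_simps power2_eq_square power3_eq_cube)
  finally show ?thesis .
qed

text \<open>The shape in which the product rule delivers the derivative of \<open>p (a + (g/m) t)\<close>, rewritten with the
  factor \<open>p\<close> in front.\<close>

lemma rescaled_product_rule:
  fixes m :: real
  assumes "m \<noteq> 0"
  shows "p * x * a + (0 + (- (g * d / (m * m)) * t + t' * (g / m))) * p = p * (x * a + g * (t' * m - t * d) / (m * m))"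
proof -
  define c where "c = g * d / (m * m)"
  have "g * (t' * m - t * d) / (m * m) = g * t' * m / (m * m) - c * t"
    unfolding c_def by (simp add: right_diff_distrib diff_divide_distrib ac_simps)
  then have e: "g * (t' * m - t * d) / (m * m) = t' * (g / m) - c * t"
    using assms by simp
  show ?thesis unfolding e c_def[symmetric] by algebra
qed

lemma rescaled_angular_metric:
  fixes p :: real
  assumes "q \<noteq> 0" "B \<noteq> 0" "p \<noteq> 0"
  shows "p * (a + (g * t - q * (x * y)) / (q * B)) = p * (a + g / (q * B) * t) - (p * x) * (p * y) / (p * B)"
proof -
  have "(p * x) * (p * y) / (p * B) = p * (x * y / B)" using assms by simp
  moreover have "(g * t - q * (x * y)) / (q * B) = g / (q * B) * t - x * y / B"
    using assms by (simp add: diff_divide_distrib)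
  ultimately show ?thesis by (simp add: right_diff_distrib distrib_left)
qed

section \<open>Linear algebra at one point\<close>

text \<open>The values \<open>\<gamma>\<close>, \<open>\<beta>\<close>, \<open>\<alpha>\<close> of the charge, of \<open>b\<^sub>i\<close> and of \<open>a\<^sub>i\<^sub>j\<close> at one point of the manifold. Within this
  locale \<open>u y\<close> is the covector \<open>a\<^sub>i\<^sub>j y\<^sup>j\<close>, \<open>y \<bullet> u y\<close> is \<open>S\<^sup>2\<close>, \<open>c2\<close> is \<open>c\<^sup>2\<close> and \<open>b\<^sub>r\<close> is the vector \<open>b\<^sup>i\<close>.\<close>

locale finsleroid_data =
  fixes \<gamma> :: real and \<beta> :: "real^'n::finite" and \<alpha> :: "real^'n^'n"
  assumes sym: "\<alpha> $ i $ j = \<alpha> $ j $ i"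
    and pos: "y \<noteq> 0 \<Longrightarrow> y \<bullet> (\<alpha> *v y) > 0"
    and norm_less: "form_norm \<alpha> \<beta> < 1"
    and charge: "\<bar>\<gamma>\<bar> < 2"
begin

abbreviation "b \<equiv> fb \<beta>"
abbreviation "q \<equiv> fq \<beta> \<alpha>"
abbreviation "B \<equiv> fB \<gamma> \<beta> \<alpha>"
abbreviation "u y \<equiv> \<alpha> *v y"
abbreviation "c2 \<equiv> (form_norm \<alpha> \<beta>)\<^sup>2"
abbreviation "b\<^sub>r \<equiv> raise \<alpha> \<beta>"
abbreviation "\<nu> \<equiv> fnu \<gamma> \<beta> \<alpha>"
abbreviation "P y \<equiv> sqK_over_B \<gamma> (b y) (q y)"

lemma b_inner: "b y = \<beta> \<bullet> y"
  by (simp add: fb_def inner_vec_def)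

lemma self_adjoint: "x \<bullet> (\<alpha> *v y) = y \<bullet> (\<alpha> *v x)"
  by (rule symmetric_matrix_inner[OF sym])

lemma inv_mult: "matrix_inv \<alpha> *v (\<alpha> *v x) = x"
  and mult_inv: "\<alpha> *v (matrix_inv \<alpha> *v x) = x"
proof -
  have "\<alpha> *v x = 0 \<Longrightarrow> x = 0" for x using pos by (metis inner_zero_right less_irrefl)
  note inv = matrix_inv_of_trivial_kernel[OF this]
  show "matrix_inv \<alpha> *v (\<alpha> *v x) = x" "\<alpha> *v (matrix_inv \<alpha> *v x) = x"
    by (simp_all add: matrix_vector_mul_assoc inv)
qed

lemma lower_raise: "\<alpha> *v b\<^sub>r = \<beta>"
  by (simp add: raise_eq mult_inv)

lemma u_inner_raise: "u y \<bullet> b\<^sub>r = b y"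
  by (metis b_inner inner_commute lower_raise self_adjoint)

lemma form_norm_radicand:
  "(\<Sum>i\<in>UNIV. \<Sum>j\<in>UNIV. matrix_inv \<alpha> $ i $ j * \<beta> $ i * \<beta> $ j) = \<beta> \<bullet> b\<^sub>r"
  by (simp add: inner_vec_def raise_def sum_distrib_left mult_ac)

lemma inner_raise_nonneg: "\<beta> \<bullet> b\<^sub>r \<ge> 0"
proof (cases "b\<^sub>r = 0")
  case False
  then show ?thesis using pos[of "b\<^sub>r"] by (simp add: lower_raise inner_commute)
qed simp

lemma c2_eq: "\<beta> \<bullet> b\<^sub>r = c2"
  using inner_raise_nonneg unfolding form_norm_def form_norm_radicand by simp

lemma c2_less: "c2 < 1"
proof -
  have "form_norm \<alpha> \<beta> \<ge> 0"
    using inner_raise_nonneg unfolding form_norm_def form_norm_radicand by simp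
  then show ?thesis using norm_less by (simp add: power_less_one_iff)
qed

lemma fS_square: "(fS \<alpha> y)\<^sup>2 = y \<bullet> u y"
proof -
  have "(\<Sum>i\<in>UNIV. \<Sum>j\<in>UNIV. \<alpha> $ i $ j * y $ i * y $ j) = y \<bullet> u y"
    by (simp add: inner_vec_def matrix_vector_mult_def sum_distrib_left mult_ac)
  moreover have "y \<bullet> u y \<ge> 0" using pos[of y] by (cases "y = 0") auto
  ultimately show ?thesis by (simp add: fS_def)
qed

lemma cauchy_schwarz: "(b y)\<^sup>2 \<le> c2 * (y \<bullet> u y)"
proof (cases "y = 0")
  case False
  define s where "s = y \<bullet> u y"
  \<comment> \<open>The vector \<open>z\<close> is \<open>S\<^sup>2\<close> times the component of \<open>b\<^sup>i\<close> that is orthogonal to \<open>y\<close>.\<close>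
  define z where "z = s *\<^sub>R b\<^sub>r - b y *\<^sub>R y"
  have s: "s > 0" using pos[OF False] by (simp add: s_def)
  have "z \<bullet> (\<alpha> *v z) = s\<^sup>2 * c2 - 2 * s * (b y)\<^sup>2 + (b y)\<^sup>2 * s"
    unfolding z_def matrix_vector_mult_diff_distrib matrix_vector_mult_scaleR lower_raise
    using u_inner_raise[of y] c2_eq
    by (simp add: inner_diff_left inner_diff_right inner_commute b_inner s_def power2_eq_square algebra_simps)
  moreover have "z \<bullet> (\<alpha> *v z) \<ge> 0" using pos[of z] by (cases "z = 0") auto
  ultimately have "s * (s * c2 - (b y)\<^sup>2) \<ge> 0" by (simp add: power2_eq_square algebra_simps)
  then show ?thesis using s by (simp add: zero_le_mult_iff s_def mult.commute)
qed (simp add: fb_def)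

lemma radicand_pos: "y \<noteq> 0 \<Longrightarrow> y \<bullet> u y - (b y)\<^sup>2 > 0"
  using cauchy_schwarz[of y] mult_strict_right_mono[OF c2_less pos[of y]] by linarith

lemma q_eq: "q y = sqrt (y \<bullet> u y - (b y)\<^sup>2)"
  by (simp add: fq_def fS_square)

lemma q_pos: "y \<noteq> 0 \<Longrightarrow> q y > 0"
  using radicand_pos[of y] by (simp add: q_eq)

lemma S_square: "y \<noteq> 0 \<Longrightarrow> y \<bullet> u y = (b y)\<^sup>2 + (q y)\<^sup>2"
  using radicand_pos[of y] by (simp add: q_eq)

lemma B_pos: "y \<noteq> 0 \<Longrightarrow> B y > 0"
  unfolding fB_def by (intro finsleroid_form_pos charge q_pos)

lemma P_pos: "y \<noteq> 0 \<Longrightarrow> P y > 0"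
  by (intro sqK_over_B_pos charge q_pos)

lemma K_square: "y \<noteq> 0 \<Longrightarrow> (fK \<gamma> \<beta> \<alpha> y)\<^sup>2 = P y * B y"
  using fK_square[OF charge q_pos] sqK_eq[OF charge q_pos] by (simp add: fB_def)

lemma K_pos: "y \<noteq> 0 \<Longrightarrow> fK \<gamma> \<beta> \<alpha> y > 0"
  by (intro fK_pos charge q_pos)

text \<open>With \<open>s = 1 - c\<^sup>2\<close>, the Cauchy-Schwarz inequality and \<open>s (1 - s) \<le> 1/4\<close> give \<open>2 s \<bar>b\<bar> \<le> q\<close>, so that
  \<open>\<bar>\<gamma>\<bar> < 2\<close> makes \<open>s \<bar>\<gamma> b\<bar>\<close> strictly smaller than \<open>q\<close>.\<close>

lemma \<nu>_pos:
  assumes "y \<noteq> 0"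
  shows "\<nu> y > 0"
proof -
  define s where "s = 1 - c2"
  have s: "0 < s" "s \<le> 1" using c2_less zero_le_power2[of "form_norm \<alpha> \<beta>"] by (auto simp: s_def)
  have "(b y)\<^sup>2 \<le> (1 - s) * ((b y)\<^sup>2 + (q y)\<^sup>2)"
    using cauchy_schwarz[of y] S_square[OF assms] by (simp add: s_def)
  then have "s * (b y)\<^sup>2 \<le> (1 - s) * (q y)\<^sup>2" by (simp add: algebra_simps)
  then have "s * (s * (b y)\<^sup>2) \<le> s * ((1 - s) * (q y)\<^sup>2)" using s by (intro mult_left_mono) auto
  moreover have "s * (1 - s) \<le> 1 / 4"
    using zero_le_power2[of "2 * s - 1"] by (simp add: power2_eq_square algebra_simps)
  then have "(s * (1 - s)) * (q y)\<^sup>2 \<le> 1 / 4 * (q y)\<^sup>2" by (intro mult_right_mono) auto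
  ultimately have "(2 * s * b y)\<^sup>2 \<le> (q y)\<^sup>2" by (simp add: power2_eq_square algebra_simps)
  then have 1: "\<bar>2 * s * b y\<bar> \<le> q y"
    using q_pos[OF assms] abs_le_square_iff[of "2 * s * b y" "q y"] by simp
  have "\<bar>s * \<gamma> * b y\<bar> < q y"
  proof (cases "b y = 0")
    case False
    then have "\<bar>\<gamma>\<bar> * \<bar>s * b y\<bar> < 2 * \<bar>s * b y\<bar>" using charge s by (intro mult_strict_right_mono) auto
    then show ?thesis using 1 by (simp add: abs_mult mult_ac)
  qed (use q_pos[OF assms] in auto)
  then show ?thesis by (simp add: fnu_def s_def)
qed

section \<open>The fundamental tensor\<close>

text \<open>The covector \<open>y\<^sub>i\<close>, half the differential of \<open>K\<^sup>2\<close>.\<close>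

definition lower :: "real^'n \<Rightarrow> real^'n" where
  "lower y = P y *\<^sub>R ((\<gamma> * q y) *\<^sub>R \<beta> + u y)"

text \<open>The fundamental tensor \<open>g\<^sub>i\<^sub>j\<close> in closed form; see \<open>fundamental_tensor_eq\<close>.\<close>

definition metric :: "real^'n \<Rightarrow> real^'n^'n" where
  "metric y = (\<chi> i j. P y * (\<alpha> $ i $ j + \<gamma> / (q y * B y) *
     ((\<gamma> * q y * (y \<bullet> u y) - b y * B y) * \<beta> $ i * \<beta> $ j - b y * u y $ i * u y $ j
      + (y \<bullet> u y) * (\<beta> $ i * u y $ j + u y $ i * \<beta> $ j))))"

text \<open>The covector \<open>e\<^sub>i = S\<^sup>2 b\<^sub>i - b u\<^sub>i\<close>, which annihilates \<open>y\<close>. The Cartan covector \<open>A\<^sub>i\<close> is a multiple of it.\<close>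

definition cartan_codir :: "real^'n \<Rightarrow> real^'n" where
  "cartan_codir y = (y \<bullet> u y) *\<^sub>R \<beta> - b y *\<^sub>R u y"

lemma DERIV_b: "((\<lambda>t. b (y + t *\<^sub>R axis k 1)) has_real_derivative \<beta> $ k) (at 0)"
  unfolding b_inner inner_add_right inner_scaleR_right inner_axis
  by (auto intro!: derivative_eq_intros)

lemma u_axis: "u (axis k 1) $ i = \<alpha> $ i $ k"
  by (simp add: matrix_vector_mult_basis column_def)

lemma DERIV_u: "((\<lambda>t. u (y + t *\<^sub>R axis k 1) $ i) has_real_derivative \<alpha> $ i $ k) (at 0)"
  unfolding matrix_vector_right_distrib matrix_vector_mult_scaleR vector_add_component vector_scaleR_component u_axis
  by (auto intro!: derivative_eq_intros)

lemma DERIV_S: "((\<lambda>t. (y + t *\<^sub>R axis k 1) \<bullet> u (y + t *\<^sub>R axis k 1)) has_real_derivative 2 * u y $ k) (at 0)"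
proof -
  have "y \<bullet> u (axis k 1) = u y $ k" using self_adjoint[of y "axis k 1"] by (simp add: inner_axis')
  moreover have "(axis k 1) \<bullet> u y = u y $ k" by (simp add: inner_axis')
  ultimately have "(y + t *\<^sub>R axis k 1) \<bullet> u (y + t *\<^sub>R axis k 1) 
    = y \<bullet> u y + t * (2 * u y $ k) + t\<^sup>2 * (axis k 1 \<bullet> u (axis k 1))" for t
    by (simp add: matrix_vector_right_distrib matrix_vector_mult_scaleR inner_add_left inner_add_right power2_eq_square algebra_simps)
  then show ?thesis by (auto intro!: derivative_eq_intros)
qed

lemma DERIV_q:
  assumes "y \<noteq> 0"
  shows "((\<lambda>t. q (y + t *\<^sub>R axis k 1)) has_real_derivative (u y $ k - b y * \<beta> $ k) / q y) (at 0)"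
proof -
  have "((\<lambda>t. (y + t *\<^sub>R axis k 1) \<bullet> u (y + t *\<^sub>R axis k 1) - (b (y + t *\<^sub>R axis k 1))\<^sup>2) has_real_derivative
     2 * (u y $ k - b y * \<beta> $ k)) (at 0)"
    by (rule derivative_eq_intros DERIV_S DERIV_b refl)+ simp
  from DERIV_chain2[OF DERIV_real_sqrt this] radicand_pos[OF assms]
  have "((\<lambda>t. q (y + t *\<^sub>R axis k 1)) has_real_derivative
     inverse (q y) / 2 * (2 * (u y $ k - b y * \<beta> $ k))) (at 0)" unfolding q_eq by simp
  then show ?thesis by (rule DERIV_cong) (use q_pos[OF assms] in \<open>simp add: field_simps\<close>)
qed

lemma axis_shift_0: "y + 0 *\<^sub>R axis k 1 = (y :: real^'n)"
  by simp

lemma DERIV_K_square: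
  assumes "y \<noteq> 0"
  shows "((\<lambda>t. (fK \<gamma> \<beta> \<alpha> (y + t *\<^sub>R axis k 1))\<^sup>2) has_real_derivative 2 * lower y $ k) (at 0)"
proof (rule DERIV_axis_cong[where D = "-{0}"])
  have r: "(b y + \<gamma> * q y) * \<beta> $ k + q y * ((u y $ k - b y * \<beta> $ k) / q y) = \<gamma> * q y * \<beta> $ k + u y $ k"
    using q_pos[OF assms] by (simp add: distrib_right)
  show "((\<lambda>t. sqK \<gamma> (b (y + t *\<^sub>R axis k 1)) (q (y + t *\<^sub>R axis k 1))) has_real_derivative 2 * lower y $ k) (at 0)"
    by (rule DERIV_cong[OF DERIV_sqK[OF DERIV_const DERIV_b DERIV_q[OF assms]]])
      (use r charge q_pos[OF assms] in \<open>simp_all add: lower_def sqK_over_B_def mult.assoc\<close>)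
qed (use assms fK_square[OF charge q_pos] in auto)

lemma DERIV_P:
  assumes "y \<noteq> 0"
  shows "((\<lambda>t. P (y + t *\<^sub>R axis k 1)) has_real_derivative
    P y * (\<gamma> / B y * (q y * \<beta> $ k - b y * ((u y $ k - b y * \<beta> $ k) / q y)))) (at 0)"
  by (rule DERIV_cong[OF DERIV_sqK_over_B[OF DERIV_const DERIV_b DERIV_q[OF assms]]])
    (use charge q_pos[OF assms] in \<open>auto simp: fB_def\<close>)

lemma DERIV_lower:
  assumes "y \<noteq> 0"
  shows "((\<lambda>t. lower (y + t *\<^sub>R axis k 1) $ j) has_real_derivative metric y $ k $ j) (at 0)"
proof -
  let ?q' = "(u y $ k - b y * \<beta> $ k) / q y"
  have "((\<lambda>t. \<gamma> * q (y + t *\<^sub>R axis k 1) * \<beta> $ j + u (y + t *\<^sub>R axis k 1) $ j) has_real_derivative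
     (\<gamma> * ?q' * \<beta> $ j + \<alpha> $ j $ k)) (at 0)"
    by (rule derivative_eq_intros DERIV_q[OF assms] DERIV_u refl)+ simp
  note d = DERIV_mult[OF DERIV_P[OF assms, of k] this]
  have factor: "p * x * s + t * p = p * (x * s + t)" for p x s t :: real
    by (simp add: algebra_simps)
  have lower: "lower z $ j = P z * (\<gamma> * q z * \<beta> $ j + u z $ j)" for z
    by (simp add: lower_def)
  have "((\<lambda>t. lower (y + t *\<^sub>R axis k 1) $ j) has_real_derivative
    P y * (\<gamma> / B y * (q y * \<beta> $ k - b y * ?q')) * (\<gamma> * q y * \<beta> $ j + u y $ j)
      + (\<gamma> * ?q' * \<beta> $ j + \<alpha> $ j $ k) * P y) (at 0)"
    using d unfolding lower axis_shift_0 .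
  note d = DERIV_cong[OF this factor]
  have id: "\<gamma> / B y * (q y * \<beta> $ k - b y * ?q') * (\<gamma> * q y * \<beta> $ j + u y $ j) + (\<gamma> * ?q' * \<beta> $ j + \<alpha> $ j $ k)
    = \<alpha> $ j $ k + \<gamma> / (q y * B y) * ((\<gamma> * q y * (y \<bullet> u y) - b y * B y) * \<beta> $ k * \<beta> $ j
       - b y * u y $ k * u y $ j + (y \<bullet> u y) * (\<beta> $ k * u y $ j + u y $ k * \<beta> $ j))"
    by (rule second_derivative_identity)
      (use q_pos[OF assms] B_pos[OF assms] S_square[OF assms] in \<open>simp_all add: fB_def\<close>)
  have "metric y $ k $ j = P y * (\<alpha> $ j $ k + \<gamma> / (q y * B y) * ((\<gamma> * q y * (y \<bullet> u y) - b y * B y) * \<beta> $ k * \<beta> $ j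
       - b y * u y $ k * u y $ j + (y \<bullet> u y) * (\<beta> $ k * u y $ j + u y $ k * \<beta> $ j)))"
    by (simp add: metric_def sym[of k j])
  then show ?thesis using d unfolding id by simp
qed

lemma fundamental_tensor_eq:
  assumes "F x = fK \<gamma> \<beta> \<alpha>" "y \<noteq> 0"
  shows "fundamental_tensor F x y = metric y"
proof -
  have 1: "pd j (\<lambda>z. (F x z)\<^sup>2) z = 2 * lower z $ j" if "z \<noteq> 0" for j z
    unfolding assms(1) by (rule pd_eqI[OF DERIV_K_square[OF that]])
  have "pd i (pd j (\<lambda>z. (F x z)\<^sup>2)) y = 2 * metric y $ i $ j" for i j
    by (rule pd_eqI, rule DERIV_axis_cong[where D = "-{0}" and h = "\<lambda>z. 2 * lower z $ j"])
      (use assms(2) 1 in \<open>auto intro!: DERIV_cmult DERIV_lower\<close>)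
  then show ?thesis by (simp add: fundamental_tensor_def vec_eq_iff)
qed

text \<open>Up to the factor \<open>K/2\<close> this is the Cartan tensor.\<close>

lemma DERIV_metric:
  assumes "y \<noteq> 0"
  shows "((\<lambda>t. metric (y + t *\<^sub>R axis k 1) $ i $ j) has_real_derivative
    \<gamma> / (q y * B y) * (cartan_codir y $ i * (metric y $ j $ k - lower y $ j * lower y $ k / (fK \<gamma> \<beta> \<alpha> y)\<^sup>2)
       + cartan_codir y $ j * (metric y $ i $ k - lower y $ i * lower y $ k / (fK \<gamma> \<beta> \<alpha> y)\<^sup>2)
       + cartan_codir y $ k * (metric y $ i $ j - lower y $ i * lower y $ j / (fK \<gamma> \<beta> \<alpha> y)\<^sup>2)
       - P y / ((q y)\<^sup>2 * B y) * (cartan_codir y $ i * cartan_codir y $ j * cartan_codir y $ k))) (at 0)"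
proof -
  let ?z = "\<lambda>t. y + t *\<^sub>R axis k 1"
  let ?e = "\<lambda>i. cartan_codir y $ i"
  define q' where "q' = (u y $ k - b y * \<beta> $ k) / q y"
  define S where "S = y \<bullet> u y"
  define B' where "B' = 2 * b y * \<beta> $ k + \<gamma> * (q' * b y + q y * \<beta> $ k) + 2 * q y * q'"
  define T where "T = (\<gamma> * q y * S - b y * B y) * \<beta> $ i * \<beta> $ j - b y * u y $ i * u y $ j + S * (\<beta> $ i * u y $ j + u y $ i * \<beta> $ j)"
  define T' where "T' = (\<gamma> * (q' * S + q y * (2 * u y $ k)) - (\<beta> $ k * B y + b y * B')) * \<beta> $ i * \<beta> $ j 
     - (\<beta> $ k * u y $ i * u y $ j + b y * (\<alpha> $ i $ k * u y $ j + u y $ i * \<alpha> $ j $ k))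
         + (2 * u y $ k * (\<beta> $ i * u y $ j + u y $ i * \<beta> $ j) + S * (\<beta> $ i * \<alpha> $ j $ k + \<alpha> $ i $ k * \<beta> $ j))"
  \<comment> \<open>\<open>h i j\<close> is the angular metric divided by \<open>P\<close>, as \<open>Ph\<close> below shows.\<close>
  define h where "h = (\<lambda>i j. \<alpha> $ i $ j - (\<gamma> * b y * S * \<beta> $ i * \<beta> $ j - \<gamma> * (b y)\<^sup>2 * (\<beta> $ i * u y $ j + u y $ i * \<beta> $ j)
      + (\<gamma> * b y + q y) * u y $ i * u y $ j) / (q y * B y))"
  note nz = q_pos[OF assms] B_pos[OF assms] P_pos[OF assms]
  have dq: "((\<lambda>t. q (?z t)) has_real_derivative q') (at 0)"
    unfolding q'_def by (rule DERIV_q[OF assms])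
  have dB: "((\<lambda>t. B (?z t)) has_real_derivative B') (at 0)"
    unfolding fB_def B'_def by (rule derivative_eq_intros dq DERIV_b refl)+ (simp add: algebra_simps)
  have dT: "((\<lambda>t. (\<gamma> * q (?z t) * ((?z t) \<bullet> u (?z t)) - b (?z t) * B (?z t)) * \<beta> $ i * \<beta> $ j
       - b (?z t) * u (?z t) $ i * u (?z t) $ j
       + ((?z t) \<bullet> u (?z t)) * (\<beta> $ i * u (?z t) $ j + u (?z t) $ i * \<beta> $ j))
      has_real_derivative T') (at 0)"
    unfolding T'_def S_def
    by (rule derivative_eq_intros dq dB DERIV_b DERIV_u DERIV_S refl)+ (simp add: algebra_simps)
  have Ph: "P y * h r s = metric y $ r $ s - lower y $ r * lower y $ s / (fK \<gamma> \<beta> \<alpha> y)\<^sup>2" for r s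
  proof -
    have *: "\<gamma> * ((\<gamma> * q y * S - b y * B y) * \<beta> $ r * \<beta> $ s - b y * u y $ r * u y $ s + S * (\<beta> $ r * u y $ s + u y $ r * \<beta> $ s))
      - q y * ((\<gamma> * q y * \<beta> $ r + u y $ r) * (\<gamma> * q y * \<beta> $ s + u y $ s))
      = - (\<gamma> * b y * S * \<beta> $ r * \<beta> $ s - \<gamma> * (b y)\<^sup>2 * (\<beta> $ r * u y $ s + u y $ r * \<beta> $ s)
      + (\<gamma> * b y + q y) * u y $ r * u y $ s)"
      unfolding S_def S_square[OF assms] fB_def by algebra
    have "h r s = \<alpha> $ r $ s + (\<gamma> * ((\<gamma> * q y * S - b y * B y) * \<beta> $ r * \<beta> $ s - b y * u y $ r * u y $ s + S * (\<beta> $ r * u y $ s + u y $ r * \<beta> $ s))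
      - q y * ((\<gamma> * q y * \<beta> $ r + u y $ r) * (\<gamma> * q y * \<beta> $ s + u y $ s))) / (q y * B y)"
      unfolding h_def * minus_divide_left[symmetric] by (rule diff_conv_add_uminus)
    then show ?thesis
      using rescaled_angular_metric[of "q y" "B y" "P y"] nz
      by (simp add: K_square[OF assms] metric_def lower_def S_def[symmetric])
  qed
  have "((\<lambda>t. metric (?z t) $ i $ j) has_real_derivative
    P y * (\<gamma> / B y * (q y * \<beta> $ k - b y * q') * (\<alpha> $ i $ j + \<gamma> / (q y * B y) * T)
     + (\<gamma> * (T' * (q y * B y) - T * (q' * B y + q y * B')) / ((q y * B y) * (q y * B y))))) (at 0)"
  proof -
    have "((\<lambda>t. \<gamma> / (q (?z t) * B (?z t))) has_real_derivative
      - (\<gamma> * (q' * B y + q y * B') / ((q y * B y) * (q y * B y)))) (at 0)"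
      by (rule derivative_eq_intros dq dB refl)+ (use nz in \<open>auto simp: mult.commute\<close>)
    note d = DERIV_mult[OF DERIV_P[OF assms, of k, folded q'_def]
      DERIV_add[OF DERIV_const[of "\<alpha> $ i $ j"] DERIV_mult[OF this dT]]]
    have metric: "metric z $ i $ j = P z * (\<alpha> $ i $ j + \<gamma> / (q z * B z) *
     ((\<gamma> * q z * (z \<bullet> u z) - b z * B z) * \<beta> $ i * \<beta> $ j - b z * u z $ i * u z $ j
      + (z \<bullet> u z) * (\<beta> $ i * u z $ j + u z $ i * \<beta> $ j)))" for z
      by (simp add: metric_def)
    have "((\<lambda>t. metric (?z t) $ i $ j) has_real_derivative
      P y * (\<gamma> / B y * (q y * \<beta> $ k - b y * q')) * (\<alpha> $ i $ j + \<gamma> / (q y * B y) * T) +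
      (0 + (- (\<gamma> * (q' * B y + q y * B') / ((q y * B y) * (q y * B y))) * T + T' * (\<gamma> / (q y * B y)))) * P y) (at 0)"
      using d unfolding metric axis_shift_0 T_def S_def .
    then show ?thesis by (rule DERIV_cong) (rule rescaled_product_rule, use nz in auto)
  qed
  also have "(\<gamma> / B y * (q y * \<beta> $ k - b y * q') * (\<alpha> $ i $ j + \<gamma> / (q y * B y) * T)
     + (\<gamma> * (T' * (q y * B y) - T * (q' * B y + q y * B')) / ((q y * B y) * (q y * B y))))
    = \<gamma> / (q y * B y) * (?e i * h j k + ?e j * h i k + ?e k * h i j - ?e i * ?e j * ?e k / ((q y)\<^sup>2 * B y))"
    by (rule third_derivative_identity[OF _ _ _ _ q'_def B'_def T_def T'_def])
      (use nz S_square[OF assms] in \<open>simp_all add: cartan_codir_def h_def S_def fB_def\<close>)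
  also have "P y * (\<gamma> / (q y * B y) * (?e i * h j k + ?e j * h i k + ?e k * h i j - ?e i * ?e j * ?e k / ((q y)\<^sup>2 * B y)))
    = \<gamma> / (q y * B y) * (?e i * (P y * h j k) + ?e j * (P y * h i k) + ?e k * (P y * h i j) - P y / ((q y)\<^sup>2 * B y) * (?e i * ?e j * ?e k))"
    by (simp add: algebra_simps)
  finally show ?thesis unfolding Ph .
qed

section \<open>Action and inverse of the fundamental tensor\<close>

lemma metric_sym: "metric y $ i $ j = metric y $ j $ i"
  by (simp add: metric_def sym[of i j] mult_ac add_ac)

lemma metric_mult: "metric y *v w = P y *\<^sub>R (\<alpha> *v w + (\<gamma> / (q y * B y)) *\<^sub>R
    (((\<gamma> * q y * (y \<bullet> u y) - b y * B y) * (\<beta> \<bullet> w) + (y \<bullet> u y) * (u y \<bullet> w)) *\<^sub>R \<beta>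
     + ((y \<bullet> u y) * (\<beta> \<bullet> w) - b y * (u y \<bullet> w)) *\<^sub>R u y))"
proof -
  define S k r where "S = y \<bullet> u y" and "k = \<gamma> * q y * (y \<bullet> u y) - b y * B y" and "r = \<gamma> / (q y * B y)"
  have "(metric y *v w) $ i = P y * ((\<alpha> *v w) $ i + r *
    ((k * (\<beta> \<bullet> w) + S * (u y \<bullet> w)) * \<beta> $ i + (S * (\<beta> \<bullet> w) - b y * (u y \<bullet> w)) * u y $ i))" for i
  proof -
    have "(metric y *v w) $ i = (\<Sum>j\<in>UNIV. P y * (\<alpha> $ i $ j * w $ j) + P y * r * k * \<beta> $ i * (\<beta> $ j * w $ j)
       - P y * r * b y * u y $ i * (u y $ j * w $ j) + P y * r * S * \<beta> $ i * (u y $ j * w $ j)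
       + P y * r * S * u y $ i * (\<beta> $ j * w $ j))"
    proof -
      have "metric y $ i $ j = P y * (\<alpha> $ i $ j + r * (k * \<beta> $ i * \<beta> $ j - b y * u y $ i * u y $ j
         + S * (\<beta> $ i * u y $ j + u y $ i * \<beta> $ j)))" for j
        by (simp add: metric_def S_def k_def r_def)
      note metric = this
      show ?thesis unfolding matrix_vector_mult_def vec_lambda_beta metric
        by (intro sum.cong refl) (simp add: algebra_simps)
    qed
    also have "\<dots> = P y * (\<alpha> *v w) $ i + P y * r * k * \<beta> $ i * (\<beta> \<bullet> w) - P y * r * b y * u y $ i * (u y \<bullet> w)
       + P y * r * S * \<beta> $ i * (u y \<bullet> w) + P y * r * S * u y $ i * (\<beta> \<bullet> w)"
      unfolding sum.distrib sum_subtractf sum_distrib_left[symmetric]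
      by (simp add: inner_vec_def matrix_vector_mult_def[of \<alpha> w])
    also have "\<dots> = P y * ((\<alpha> *v w) $ i + r *
      ((k * (\<beta> \<bullet> w) + S * (u y \<bullet> w)) * \<beta> $ i + (S * (\<beta> \<bullet> w) - b y * (u y \<bullet> w)) * u y $ i))"
      by (simp add: algebra_simps)
    finally show ?thesis .
  qed
  then show ?thesis by (simp add: vec_eq_iff S_def k_def r_def)
qed

lemma metric_mult_y:
  assumes "y \<noteq> 0"
  shows "metric y *v y = lower y"
proof -
  note nz = q_pos[OF assms] B_pos[OF assms]
  have 1: "(\<gamma> * q y * (y \<bullet> u y) - b y * B y) * b y + (y \<bullet> u y) * (y \<bullet> u y) = (q y)\<^sup>2 * B y"
    unfolding S_square[OF assms] fB_def by algebra
  have 2: "\<gamma> / (q y * B y) * ((q y)\<^sup>2 * B y) = \<gamma> * q y" using nz by (simp add: power2_eq_square)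
  have "u y \<bullet> y = y \<bullet> u y" "\<beta> \<bullet> y = b y" by (simp_all add: inner_commute b_inner)
  then show ?thesis
    unfolding metric_mult by (simp only: 1 scaleR_add_right scaleR_scaleR 2) (simp add: lower_def algebra_simps)
qed

text \<open>The vector \<open>B b\<^sup>i - (b + g q c\<^sup>2) y\<^sup>i\<close>. Lowering its index gives a multiple of \<open>e\<^sub>i\<close>, so the Cartan vector
  \<open>A\<^sup>i\<close> is a multiple of it.\<close>

definition cartan_dir :: "real^'n \<Rightarrow> real^'n" where
  "cartan_dir y = B y *\<^sub>R b\<^sub>r - (b y + \<gamma> * q y * c2) *\<^sub>R y"

lemma inner_cartan_dir:
  shows "\<beta> \<bullet> cartan_dir y = B y * c2 - (b y + \<gamma> * q y * c2) * b y"
    and "u y \<bullet> cartan_dir y = B y * b y - (b y + \<gamma> * q y * c2) * (y \<bullet> u y)"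
    and "u (cartan_dir y) = B y *\<^sub>R \<beta> - (b y + \<gamma> * q y * c2) *\<^sub>R u y"
  by (simp_all add: cartan_dir_def inner_diff_right c2_eq u_inner_raise b_inner inner_commute[of "u y" y]
      matrix_vector_mult_diff_distrib matrix_vector_mult_scaleR lower_raise)

lemma metric_mult_cartan_dir:
  assumes "y \<noteq> 0"
  shows "metric y *v cartan_dir y = (P y * \<nu> y / q y) *\<^sub>R cartan_codir y"
proof -
  note nz = q_pos[OF assms] B_pos[OF assms]
  define r where "r = \<gamma> / (q y * B y)"
  have r: "r * (q y * B y) = \<gamma>" using nz by (simp add: r_def)
  have \<nu>: "\<nu> y = q y + (1 - c2) * \<gamma> * b y" by (simp add: fnu_def)
  \<comment> \<open>\<open>k1\<close> and \<open>k2\<close> are the coefficients of \<open>\<beta>\<close> and \<open>u y\<close> in \<open>metric_mult\<close>.\<close>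
  define k1 where "k1 = (\<gamma> * q y * (y \<bullet> u y) - b y * B y) * (\<beta> \<bullet> cartan_dir y) + (y \<bullet> u y) * (u y \<bullet> cartan_dir y)"
  define k2 where "k2 = (y \<bullet> u y) * (\<beta> \<bullet> cartan_dir y) - b y * (u y \<bullet> cartan_dir y)"
  have "q y * (B y + r * k1) * B y = \<nu> y * (y \<bullet> u y) * B y"
  proof -
    have "q y * (B y + r * k1) * B y = q y * B y * B y + r * (q y * B y) * k1" by algebra
    also have "\<dots> = \<nu> y * (y \<bullet> u y) * B y"
      unfolding r unfolding k1_def inner_cartan_dir \<nu> S_square[OF assms] fB_def by algebra
    finally show ?thesis .
  qed
  then have "q y * (B y + r * k1) = \<nu> y * (y \<bullet> u y)" using nz by (metis less_irrefl mult_right_cancel)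
  then have 1: "B y + r * k1 = \<nu> y / q y * (y \<bullet> u y)" using nz by (simp add: field_simps)
  have "q y * (r * k2 - (b y + \<gamma> * q y * c2)) * B y = - (\<nu> y * b y) * B y"
  proof -
    have "q y * (r * k2 - (b y + \<gamma> * q y * c2)) * B y = r * (q y * B y) * k2 - q y * B y * (b y + \<gamma> * q y * c2)" by algebra
    also have "\<dots> = - (\<nu> y * b y) * B y"
      unfolding r unfolding k2_def inner_cartan_dir \<nu> S_square[OF assms] fB_def by algebra
    finally show ?thesis .
  qed
  then have "q y * (r * k2 - (b y + \<gamma> * q y * c2)) = - (\<nu> y * b y)" using nz by (metis less_irrefl mult_right_cancel)
  then have 2: "r * k2 - (b y + \<gamma> * q y * c2) = - (\<nu> y / q y * b y)" using nz by (simp add: field_simps)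
  have "metric y *v cartan_dir y = P y *\<^sub>R ((B y + r * k1) *\<^sub>R \<beta> + (r * k2 - (b y + \<gamma> * q y * c2)) *\<^sub>R u y)"
    unfolding metric_mult r_def[symmetric] k1_def[symmetric] k2_def[symmetric] inner_cartan_dir(3)
    by (simp add: algebra_simps)
  then show ?thesis unfolding 1 2 cartan_codir_def by (simp add: algebra_simps)
qed

lemma metric_mult_v:
  assumes "y \<noteq> 0"
  shows "metric y *v fv \<beta> \<alpha> y = (P y * \<nu> y / (q y * B y)) *\<^sub>R
     ((\<gamma> * q y * (y \<bullet> u y) - b y * B y) *\<^sub>R \<beta> + (y \<bullet> u y) *\<^sub>R u y)"
proof -
  note nz = q_pos[OF assms] B_pos[OF assms]
  define r where "r = \<gamma> / (q y * B y)"
  have r: "r * (q y * B y) = \<gamma>" using nz by (simp add: r_def)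
  have \<nu>: "\<nu> y = q y + (1 - c2) * \<gamma> * b y" by (simp add: fnu_def)
  define k where "k = \<gamma> * q y * (y \<bullet> u y) - b y * B y"
  have \<beta>y: "\<beta> \<bullet> y = b y" by (simp add: b_inner)
  have i: "\<beta> \<bullet> fv \<beta> \<alpha> y = b y * (1 - c2)" "u y \<bullet> fv \<beta> \<alpha> y = (q y)\<^sup>2" "u (fv \<beta> \<alpha> y) = u y - b y *\<^sub>R \<beta>"
    using S_square[OF assms]
    by (simp_all add: fv_def inner_diff_right c2_eq u_inner_raise \<beta>y inner_commute[of "u y" y]
      matrix_vector_mult_diff_distrib matrix_vector_mult_scaleR lower_raise right_diff_distrib power2_eq_square)
  define k1 where "k1 = k * (b y * (1 - c2)) + (y \<bullet> u y) * (q y)\<^sup>2"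
  define k2 where "k2 = (y \<bullet> u y) * (b y * (1 - c2)) - b y * (q y)\<^sup>2"
  have "(r * k1 - b y) * (q y * B y) = \<nu> y * k"
  proof -
    have "(r * k1 - b y) * (q y * B y) = r * (q y * B y) * k1 - b y * (q y * B y)" by algebra
    also have "\<dots> = \<nu> y * k" unfolding r unfolding k1_def k_def \<nu> S_square[OF assms] fB_def by algebra
    finally show ?thesis .
  qed
  then have 1: "r * k1 - b y = \<nu> y / (q y * B y) * k" using nz by (simp add: field_simps)
  have "(1 + r * k2) * (q y * B y) = \<nu> y * (y \<bullet> u y)"
  proof -
    have "(1 + r * k2) * (q y * B y) = q y * B y + r * (q y * B y) * k2" by algebra
    also have "\<dots> = \<nu> y * (y \<bullet> u y)" unfolding r unfolding k2_def k_def \<nu> S_square[OF assms] fB_def by algebra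
    finally show ?thesis .
  qed
  then have 2: "1 + r * k2 = \<nu> y / (q y * B y) * (y \<bullet> u y)" using nz by (simp add: field_simps)
  have "metric y *v fv \<beta> \<alpha> y = P y *\<^sub>R ((r * k1 - b y) *\<^sub>R \<beta> + (1 + r * k2) *\<^sub>R u y)"
    unfolding metric_mult i r_def[symmetric] k_def[symmetric] k1_def[symmetric] k2_def[symmetric]
    by (simp add: algebra_simps)
  then show ?thesis unfolding 1 2 k_def[symmetric] by (simp add: algebra_simps)
qed

lemma inner_lower:
  assumes "y \<noteq> 0"
  shows "y \<bullet> lower y = (fK \<gamma> \<beta> \<alpha> y)\<^sup>2"
  unfolding K_square[OF assms] using S_square[OF assms]
  by (simp add: lower_def fB_def b_inner[symmetric] inner_add_right inner_commute[of y \<beta>] power2_eq_square algebra_simps)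

text \<open>For \<open>w\<close> in the kernel, pairing \<open>g\<^sub>i\<^sub>j w\<^sup>j = 0\<close> with \<open>y\<close> and with \<open>cartan_dir y\<close> gives two independent
  linear equations for \<open>b\<^sub>i w\<^sup>i\<close> and \<open>u\<^sub>i w\<^sup>i\<close>; when both vanish, \<open>g\<^sub>i\<^sub>j w\<^sup>j\<close> is \<open>P\<close> times \<open>a\<^sub>i\<^sub>j w\<^sup>j\<close>.\<close>

lemma metric_trivial_kernel:
  assumes "y \<noteq> 0" "metric y *v w = 0"
  shows "w = 0"
proof -
  note nz = q_pos[OF assms(1)] B_pos[OF assms(1)] P_pos[OF assms(1)] \<nu>_pos[OF assms(1)]
  have "w \<bullet> lower y = y \<bullet> (metric y *v w)"
    unfolding metric_mult_y[OF assms(1), symmetric] by (rule symmetric_matrix_inner[OF metric_sym])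
  then have 1: "\<gamma> * q y * (\<beta> \<bullet> w) + u y \<bullet> w = 0"
    using nz by (simp add: assms(2) lower_def inner_add_right inner_commute[of w])
  have "w \<bullet> ((P y * \<nu> y / q y) *\<^sub>R cartan_codir y) = cartan_dir y \<bullet> (metric y *v w)"
    unfolding metric_mult_cartan_dir[OF assms(1), symmetric] by (rule symmetric_matrix_inner[OF metric_sym])
  then have 2: "(y \<bullet> u y) * (\<beta> \<bullet> w) - b y * (u y \<bullet> w) = 0"
    using nz by (simp add: assms(2) cartan_codir_def inner_diff_right inner_commute[of w])
  have "B y * (\<beta> \<bullet> w) = 0"
    using 1 2 unfolding S_square[OF assms(1)] fB_def by algebra
  then have \<beta>: "\<beta> \<bullet> w = 0" using nz by simp
  with 1 have "u y \<bullet> w = 0" by simp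
  with \<beta> assms(2) have "\<alpha> *v w = 0" using nz unfolding metric_mult by simp
  then show "w = 0" using pos[of w] by fastforce
qed

lemma metric_inverse:
  assumes "y \<noteq> 0"
  shows "metric y ** matrix_inv (metric y) = mat 1" "matrix_inv (metric y) ** metric y = mat 1"
  by (rule matrix_inv_of_trivial_kernel, erule metric_trivial_kernel[OF assms])+

lemma metric_inv_mult: "y \<noteq> 0 \<Longrightarrow> matrix_inv (metric y) *v (metric y *v w) = w"
  by (simp add: matrix_vector_mul_assoc metric_inverse)

lemma metric_mult_inv: "y \<noteq> 0 \<Longrightarrow> metric y *v (matrix_inv (metric y) *v w) = w"
  by (simp add: matrix_vector_mul_assoc metric_inverse)

lemma metric_inv_cartan_codir:
  assumes "y \<noteq> 0"
  shows "matrix_inv (metric y) *v cartan_codir y = (q y / (P y * \<nu> y)) *\<^sub>R cartan_dir y"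
proof -
  note nz = q_pos[OF assms] P_pos[OF assms] \<nu>_pos[OF assms]
  have "cartan_codir y = (q y / (P y * \<nu> y)) *\<^sub>R (metric y *v cartan_dir y)"
    unfolding metric_mult_cartan_dir[OF assms] using nz by simp
  also have "\<dots> = metric y *v ((q y / (P y * \<nu> y)) *\<^sub>R cartan_dir y)" by (simp add: matrix_vector_mult_scaleR)
  finally show ?thesis using metric_inv_mult[OF assms] by metis
qed

section \<open>The Cartan vector\<close>

lemma cartan_form_eq:
  assumes F: "F x = fK \<gamma> \<beta> \<alpha>" and y: "y \<noteq> 0"
  shows "cartan_form F x y = (fK \<gamma> \<beta> \<alpha> y / 2 * (\<gamma> / (q y * B y)) / fX \<gamma> \<beta> \<alpha> y) *\<^sub>R cartan_codir y"
proof -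
  note nz = q_pos[OF y] P_pos[OF y] \<nu>_pos[OF y] B_pos[OF y]
  define K where "K = fK \<gamma> \<beta> \<alpha> y"
  define t where "t = P y / ((q y)\<^sup>2 * B y)"
  have K: "K > 0" "K\<^sup>2 = P y * B y" using K_pos[OF y] K_square[OF y] by (auto simp: K_def)
  have "cartan_tensor F x y i j k = K / 2 * (\<gamma> / (q y * B y) * (cartan_codir y $ i * (metric y $ j $ k - lower y $ j * lower y $ k / K\<^sup>2)
       + cartan_codir y $ j * (metric y $ i $ k - lower y $ i * lower y $ k / K\<^sup>2)
       + cartan_codir y $ k * (metric y $ i $ j - lower y $ i * lower y $ j / K\<^sup>2)
       - t * (cartan_codir y $ i * cartan_codir y $ j * cartan_codir y $ k)))" for i j k
  proof -
    note d = DERIV_metric[OF y, where i = i and j = j and k = k, folded K_def t_def]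
    have "pd k (\<lambda>z. fundamental_tensor F x z $ i $ j) y = \<gamma> / (q y * B y) * (cartan_codir y $ i * (metric y $ j $ k - lower y $ j * lower y $ k / K\<^sup>2)
       + cartan_codir y $ j * (metric y $ i $ k - lower y $ i * lower y $ k / K\<^sup>2)
       + cartan_codir y $ k * (metric y $ i $ j - lower y $ i * lower y $ j / K\<^sup>2)
       - t * (cartan_codir y $ i * cartan_codir y $ j * cartan_codir y $ k))"
      by (rule pd_eqI, rule DERIV_axis_cong[where D = "-{0}" and h = "\<lambda>z. metric z $ i $ j", OF _ _ _ d])
        (use y fundamental_tensor_eq[where F = F and x = x, OF F] in auto)
    then show ?thesis unfolding cartan_tensor_def F K_def[symmetric] by simp
  qed
  then have A: "cartan_form F x y $ i = K / 2 * (\<gamma> / (q y * B y)) * (\<Sum>j\<in>UNIV. \<Sum>k\<in>UNIV. matrix_inv (metric y) $ j $ k *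
      (cartan_codir y $ i * (metric y $ j $ k - lower y $ j * lower y $ k / K\<^sup>2)
       + cartan_codir y $ j * (metric y $ i $ k - lower y $ i * lower y $ k / K\<^sup>2)
       + cartan_codir y $ k * (metric y $ i $ j - lower y $ i * lower y $ j / K\<^sup>2)
       - t * (cartan_codir y $ i * cartan_codir y $ j * cartan_codir y $ k)))" for i
    unfolding cartan_form_def fundamental_tensor_eq[where F = F and x = x, OF F y] sum_distrib_left
    by (simp add: mult.left_commute mult.assoc)
  have ly: "matrix_inv (metric y) *v lower y = y"
    using metric_inv_mult[OF y] unfolding metric_mult_y[OF y, symmetric] .
  have ll: "lower y \<bullet> y = K\<^sup>2"
    unfolding K_def inner_lower[OF y, symmetric] by (rule inner_commute)
  have ey: "cartan_codir y \<bullet> y = 0"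
    by (simp add: cartan_codir_def inner_diff_left b_inner[symmetric] inner_commute[of "u y"])
  have lz: "lower y \<bullet> cartan_dir y = 0"
    unfolding lower_def inner_scaleR_left inner_add_left inner_cartan_dir S_square[OF y] fB_def by algebra
  have ez: "cartan_codir y \<bullet> cartan_dir y = B y * ((y \<bullet> u y) * c2 - (b y)\<^sup>2)"
    unfolding cartan_codir_def inner_scaleR_left inner_diff_left inner_cartan_dir by algebra
  \<comment> \<open>The summand \<open>- 1\<close> is the contraction of \<open>y\<^sub>j y\<^sub>k / K\<^sup>2\<close>, and the one with \<open>t\<close> that of the cubic term;
    the mixed contractions of \<open>y\<^sub>i\<close> and \<open>e\<^sub>i\<close> vanish by \<open>ey\<close> and \<open>lz\<close>.\<close>
  have N: "real CARD('n) + 2 - 1 - t * (q y / (P y * \<nu> y) * (B y * ((y \<bullet> u y) * c2 - (b y)\<^sup>2))) = 1 / fX \<gamma> \<beta> \<alpha> y"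
  proof -
    have "t * (q y / (P y * \<nu> y) * (B y * ((y \<bullet> u y) * c2 - (b y)\<^sup>2))) = ((y \<bullet> u y) * c2 - (b y)\<^sup>2) / (q y * \<nu> y)"
      unfolding t_def using nz by (simp add: power2_eq_square)
    moreover have "q y * \<nu> y - ((y \<bullet> u y) * c2 - (b y)\<^sup>2) = (1 - c2) * B y"
      unfolding S_square[OF y] fB_def fnu_def by algebra
    then have "1 - ((y \<bullet> u y) * c2 - (b y)\<^sup>2) / (q y * \<nu> y) = (1 - c2) * B y / (q y * \<nu> y)"
      using nz by (simp add: field_simps)
    ultimately show ?thesis unfolding fX_def by simp
  qed
  have "cartan_form F x y $ i = K / 2 * (\<gamma> / (q y * B y)) * (cartan_codir y $ i * (1 / fX \<gamma> \<beta> \<alpha> y))" for i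
    unfolding A trace_of_cubic_form[OF metric_sym metric_inverse(2,1)[OF y]] ly metric_inv_cartan_codir[OF y] inner_scaleR_right
      ll ey lz ez using N K(1) by simp
  then show ?thesis by (simp add: vec_eq_iff K_def)
qed

lemma fX_pos:
  assumes "y \<noteq> 0" shows "fX \<gamma> \<beta> \<alpha> y > 0"
proof -
  have "(1 - c2) * B y / (q y * \<nu> y) > 0"
    using c2_less q_pos[OF assms] \<nu>_pos[OF assms] B_pos[OF assms] by simp
  then show ?thesis unfolding fX_def by (simp add: add_nonneg_pos)
qed

text \<open>Both cases of the definition give the same vector: for \<open>\<gamma> \<noteq> 0\<close> the factors \<open>\<gamma>\<close> and \<open>1/X\<close> contained in
  \<open>A\<^sup>i\<close> cancel.\<close>

lemma XA_over_g_eq: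
  assumes "gf x = \<gamma>" "bf x = \<beta>" "af x = \<alpha>" "y \<noteq> 0"
  shows "XA_over_g gf bf af x y = (1 / (2 * fK \<gamma> \<beta> \<alpha> y * \<nu> y)) *\<^sub>R cartan_dir y"
proof -
  note y = \<open>y \<noteq> 0\<close>
  note nz = q_pos[OF y] P_pos[OF y] \<nu>_pos[OF y] B_pos[OF y] K_pos[OF y] fX_pos[OF y]
  have F: "K_field gf bf af x = fK \<gamma> \<beta> \<alpha>" using assms by (simp add: K_field_def fun_eq_iff)
  have "cartan_vector (K_field gf bf af) x y
    = (fK \<gamma> \<beta> \<alpha> y / 2 * (\<gamma> / (q y * B y)) / fX \<gamma> \<beta> \<alpha> y * (q y / (P y * \<nu> y))) *\<^sub>R cartan_dir y"
    unfolding cartan_vector_def fundamental_tensor_eq[where F = "K_field gf bf af" and x = x, OF F y] raise_eq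
      cartan_form_eq[where F = "K_field gf bf af" and x = x, OF F y] matrix_vector_mult_scaleR metric_inv_cartan_codir[OF y] by simp
  moreover have "1 / \<gamma> * fX \<gamma> \<beta> \<alpha> y * (fK \<gamma> \<beta> \<alpha> y / 2 * (\<gamma> / (q y * B y)) / fX \<gamma> \<beta> \<alpha> y * (q y / (P y * \<nu> y)))
    = 1 / (2 * fK \<gamma> \<beta> \<alpha> y * \<nu> y)" if "\<gamma> \<noteq> 0"
  proof -
    have "1 / \<gamma> * fX \<gamma> \<beta> \<alpha> y * (fK \<gamma> \<beta> \<alpha> y / 2 * (\<gamma> / (q y * B y)) / fX \<gamma> \<beta> \<alpha> y * (q y / (P y * \<nu> y)))
      = fK \<gamma> \<beta> \<alpha> y / (2 * (P y * B y) * \<nu> y)" using that nz by simp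
    also have "\<dots> = 1 / (2 * fK \<gamma> \<beta> \<alpha> y * \<nu> y)"
      unfolding K_square[OF y, symmetric] using nz by (simp add: power2_eq_square)
    finally show ?thesis .
  qed
  ultimately show ?thesis
    unfolding XA_over_g_def assms(1-3) F by (auto simp: cartan_dir_def)
qed

section \<open>The lowered spray at one point\<close>

text \<open>The claimed spray vector with its index lowered. The free symbols stand for data at the point: \<open>\<Gamma>\<close> for
  the Riemannian spray, \<open>f\<close> for the curl vector \<open>f\<^sup>i\<close>, \<open>s\<close> for \<open>y\<^sup>j y\<^sup>h \<nabla>\<^sub>j b\<^sub>h\<close>, \<open>m\<close> for \<open>M\<close>, \<open>dg\<close> for the
  differential of the charge, and \<open>Db\<close>, \<open>DS\<close>, \<open>Dq\<close>, \<open>Dg\<close> for the derivatives of \<open>b\<close>, \<open>S\<^sup>2/2\<close>, \<open>q\<close> and the charge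
  in \<open>x\<close> along \<open>y\<close>. The coefficient of \<open>fv \<beta> \<alpha> y\<close> is what cancels the terms with \<open>s\<close> from \<open>\<Gamma>\<close> and with
  \<open>\<phi>\<close> from \<open>f\<close>.\<close>

lemma lowered_spray:
  fixes \<Gamma> f dg :: "real^'n"
  assumes y: "y \<noteq> 0"
    and \<Gamma>: "\<beta> \<bullet> \<Gamma> = Db - s" "u y \<bullet> \<Gamma> = DS" and f: "u y \<bullet> f = 0" "\<beta> \<bullet> f = \<phi>"
    and Dq: "Dq = (DS - b y * Db) / q y"
  shows "metric y *v ((\<gamma> / \<nu> y * (s + \<gamma> * q y * \<phi>)) *\<^sub>R fv \<beta> \<alpha> y - (\<gamma> * q y) *\<^sub>R f
      + ((m * Dg) *\<^sub>R y + ((q y)\<^sup>2 / (B y * \<nu> y) * Dg) *\<^sub>R cartan_dir y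
          - (1/2 * m * (P y * B y)) *\<^sub>R (matrix_inv (metric y) *v dg)) + \<Gamma>)
    = (P y * (\<gamma> / B y * (q y * Db - b y * Dq) + (m - q y * b y / B y) * Dg)) *\<^sub>R ((\<gamma> * q y) *\<^sub>R \<beta> + u y)
      + P y *\<^sub>R ((Dg * q y + \<gamma> * Dq) *\<^sub>R \<beta> - (\<gamma> * q y) *\<^sub>R (\<alpha> *v f) + \<alpha> *v \<Gamma>)
      - (1/2 * m * (P y * B y)) *\<^sub>R dg" (is "?L = ?R")
proof -
  note nz = q_pos[OF y] B_pos[OF y] \<nu>_pos[OF y]
  define S where "S = y \<bullet> u y"
  define k where "k = \<gamma> * q y * S - b y * B y"
  define r where "r = \<gamma> / (q y * B y)"
  have S: "S = B y - \<gamma> * q y * b y" "S = (b y)\<^sup>2 + (q y)\<^sup>2"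
    by (simp_all add: S_def S_square[OF y] fB_def)
  have Dq': "q y * Dq = DS - b y * Db" using nz Dq by simp
  have 1: "\<gamma> / B y * (q y * Db - b y * Dq) = r * (S * Db - b y * DS)"
  proof -
    have "q y * (q y * Db - b y * Dq) = S * Db - b y * DS" using Dq' unfolding S(2) by algebra
    moreover have "\<gamma> / B y * (q y * Db - b y * Dq) = r * (q y * (q y * Db - b y * Dq))"
      using nz by (simp add: r_def)
    ultimately show ?thesis by simp
  qed
  have 2: "r * (S * Db - b y * DS) * (\<gamma> * q y) + \<gamma> * Dq = r * (k * Db + S * DS)"
  proof -
    have "\<gamma> * Dq = r * (B y * (q y * Dq))" using nz by (simp add: r_def)
    then show ?thesis unfolding Dq' k_def using S(1) by algebra
  qed
  have 3: "q y / B y * S = q y - q y * b y / B y * (\<gamma> * q y)"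
    unfolding S(1) using nz by (simp add: field_simps)
  have G: "metric y *v \<Gamma> = P y *\<^sub>R (\<alpha> *v \<Gamma> + r *\<^sub>R ((k * (Db - s) + S * DS) *\<^sub>R \<beta> + (S * (Db - s) - b y * DS) *\<^sub>R u y))"
    unfolding metric_mult \<Gamma> by (simp add: S_def k_def r_def)
  have F: "metric y *v f = P y *\<^sub>R (\<alpha> *v f + r *\<^sub>R ((k * \<phi>) *\<^sub>R \<beta> + (S * \<phi>) *\<^sub>R u y))"
    unfolding metric_mult f by (simp add: S_def k_def r_def)
  have V: "metric y *v ((\<gamma> / \<nu> y * (s + \<gamma> * q y * \<phi>)) *\<^sub>R fv \<beta> \<alpha> y) = (P y * r * (s + \<gamma> * q y * \<phi>)) *\<^sub>R (k *\<^sub>R \<beta> + S *\<^sub>R u y)"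
  proof -
    have "\<gamma> / \<nu> y * (s + \<gamma> * q y * \<phi>) * (P y * \<nu> y / (q y * B y)) = P y * r * (s + \<gamma> * q y * \<phi>)"
      using nz by (simp add: r_def)
    then show ?thesis
      unfolding matrix_vector_mult_scaleR metric_mult_v[OF y] scaleR_scaleR by (simp only: k_def S_def)
  qed
  have Z: "metric y *v (((q y)\<^sup>2 / (B y * \<nu> y) * Dg) *\<^sub>R cartan_dir y) = (P y * Dg * (q y / B y)) *\<^sub>R (S *\<^sub>R \<beta> - b y *\<^sub>R u y)"
  proof -
    have "(q y)\<^sup>2 / (B y * \<nu> y) * Dg * (P y * \<nu> y / q y) = P y * Dg * (q y / B y)"
      using nz by (simp add: power2_eq_square)
    then show ?thesis
      unfolding matrix_vector_mult_scaleR metric_mult_cartan_dir[OF y] scaleR_scaleR by (simp only: cartan_codir_def S_def)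
  qed
  define w where "w = q y / B y"
  have L: "?L = (P y * r * (s + \<gamma> * q y * \<phi>)) *\<^sub>R (k *\<^sub>R \<beta> + S *\<^sub>R u y)
      - (\<gamma> * q y) *\<^sub>R (P y *\<^sub>R (\<alpha> *v f + r *\<^sub>R ((k * \<phi>) *\<^sub>R \<beta> + (S * \<phi>) *\<^sub>R u y)))
      + ((m * Dg) *\<^sub>R (P y *\<^sub>R ((\<gamma> * q y) *\<^sub>R \<beta> + u y)) + (P y * Dg * w) *\<^sub>R (S *\<^sub>R \<beta> - b y *\<^sub>R u y)
          - (1/2 * m * (P y * B y)) *\<^sub>R dg)
      + P y *\<^sub>R (\<alpha> *v \<Gamma> + r *\<^sub>R ((k * (Db - s) + S * DS) *\<^sub>R \<beta> + (S * (Db - s) - b y * DS) *\<^sub>R u y))"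
    unfolding matrix_vector_right_distrib matrix_vector_mult_diff_distrib V Z G
    unfolding matrix_vector_mult_scaleR F metric_mult_y[OF y] metric_mult_inv[OF y] lower_def w_def ..
  have R: "?R = (P y * (r * (S * Db - b y * DS) + (m - w * b y) * Dg)) *\<^sub>R ((\<gamma> * q y) *\<^sub>R \<beta> + u y)
      + P y *\<^sub>R ((Dg * q y + \<gamma> * Dq) *\<^sub>R \<beta> - (\<gamma> * q y) *\<^sub>R (\<alpha> *v f) + \<alpha> *v \<Gamma>)
      - (1/2 * m * (P y * B y)) *\<^sub>R dg"
    unfolding 1 by (simp add: w_def)
  have 3: "w * S = q y - w * b y * (\<gamma> * q y)" using 3 by (simp add: w_def)
  have "?L $ i = ?R $ i" for i
    unfolding L R
    unfolding vector_add_component vector_minus_component vector_scaleR_component real_scaleR_def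
    using 2 3 by algebra
  then show ?thesis by (simp add: vec_eq_iff)
qed

end

section \<open>The spray coefficients in a chart\<close>

text \<open>The data of a Finsleroid-regular space in the coordinates of one chart. Pointwise conditions and first
  derivatives suffice; tensoriality plays no role within a single chart.\<close>

locale finsleroid_field =
  fixes D :: "(real^'n::finite) set" and gf :: "real^'n \<Rightarrow> real"
    and bf :: "real^'n \<Rightarrow> real^'n" and af :: "real^'n \<Rightarrow> real^'n^'n"
  assumes open_D: "open D"
    and data: "z \<in> D \<Longrightarrow> finsleroid_data (gf z) (bf z) (af z)"
    and diff_g: "gf differentiable_on D"
    and diff_b: "(\<lambda>z. bf z $ i) differentiable_on D"
    and diff_a: "(\<lambda>z. af z $ i $ j) differentiable_on D"
begin

context
  fixes x y :: "real^'n"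
  assumes x: "x \<in> D" and y: "y \<noteq> 0"
begin

interpretation p: finsleroid_data "gf x" "bf x" "af x" by (rule data[OF x])

text \<open>From here on \<open>x\<close> and \<open>y\<close> are fixed. The abbreviations beginning with \<open>d\<close> are the partial derivatives
  with respect to \<open>x\<^sup>k\<close>, at fixed \<open>y\<close>, of \<open>g\<close>, \<open>b\<^sub>i\<close>, \<open>b\<close>, \<open>S\<^sup>2\<close>, \<open>u\<^sub>i\<close> and \<open>q\<close>.\<close>

abbreviation "\<gamma> \<equiv> gf x"
abbreviation "\<beta> \<equiv> bf x"
abbreviation "\<alpha> \<equiv> af x"
abbreviation "b \<equiv> fb \<beta> y"
abbreviation "q \<equiv> fq \<beta> \<alpha> y"
abbreviation "B \<equiv> fB \<gamma> \<beta> \<alpha> y"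
abbreviation "P \<equiv> sqK_over_B \<gamma> b q"
abbreviation "m \<equiv> charge_deriv \<gamma> b q"
abbreviation "dg \<equiv> (\<chi> k. pd k gf x)"
abbreviation "d\<beta> k i \<equiv> pd k (\<lambda>z. bf z $ i) x"
abbreviation "db k \<equiv> pd k (\<lambda>z. fb (bf z) y) x"
abbreviation "dS k \<equiv> pd k (\<lambda>z. y \<bullet> (af z *v y)) x"
abbreviation "du k i \<equiv> pd k (\<lambda>z. (af z *v y) $ i) x"
abbreviation "dq k \<equiv> (dS k / 2 - b * db k) / q"

lemma DERIV_gf: "((\<lambda>t. gf (x + t *\<^sub>R axis k 1)) has_real_derivative dg $ k) (at 0)"
  using DERIV_pd[OF diff_g open_D x] by simp

lemma DERIV_bf: "((\<lambda>t. bf (x + t *\<^sub>R axis k 1) $ i) has_real_derivative d\<beta> k i) (at 0)"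
  by (rule DERIV_pd[OF diff_b open_D x])

lemma DERIV_af: "((\<lambda>t. af (x + t *\<^sub>R axis k 1) $ i $ j) has_real_derivative pd k (\<lambda>z. af z $ i $ j) x) (at 0)"
  by (rule DERIV_pd[OF diff_a open_D x])

lemma db_eq: "db k = (\<Sum>i\<in>UNIV. d\<beta> k i * y $ i)"
  and DERIV_fb: "((\<lambda>t. fb (bf (x + t *\<^sub>R axis k 1)) y) has_real_derivative db k) (at 0)"
proof -
  have "((\<lambda>t. fb (bf (x + t *\<^sub>R axis k 1)) y) has_real_derivative (\<Sum>i\<in>UNIV. d\<beta> k i * y $ i)) (at 0)"
    unfolding fb_def by (auto intro!: derivative_eq_intros DERIV_bf)
  then show "db k = (\<Sum>i\<in>UNIV. d\<beta> k i * y $ i)" 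
    "((\<lambda>t. fb (bf (x + t *\<^sub>R axis k 1)) y) has_real_derivative db k) (at 0)"
    by (rule pd_eqI, rule DERIV_pdI)
qed

lemma DERIV_ay: "((\<lambda>t. (af (x + t *\<^sub>R axis k 1) *v y) $ i) has_real_derivative du k i) (at 0)"
proof -
  have "((\<lambda>t. (af (x + t *\<^sub>R axis k 1) *v y) $ i) has_real_derivative (\<Sum>j\<in>UNIV. pd k (\<lambda>z. af z $ i $ j) x * y $ j)) (at 0)"
    unfolding matrix_vector_mult_def by (auto intro!: derivative_eq_intros DERIV_af)
  then show ?thesis by (rule DERIV_pdI)
qed

lemma dS_eq: "dS k = (\<Sum>i\<in>UNIV. y $ i * du k i)"
  and DERIV_yay: "((\<lambda>t. y \<bullet> (af (x + t *\<^sub>R axis k 1) *v y)) has_real_derivative dS k) (at 0)"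
proof -
  have "((\<lambda>t. y \<bullet> (af (x + t *\<^sub>R axis k 1) *v y)) has_real_derivative (\<Sum>i\<in>UNIV. y $ i * du k i)) (at 0)"
    unfolding inner_vec_def by (auto intro!: derivative_eq_intros DERIV_ay sum.cong)
  then show "dS k = (\<Sum>i\<in>UNIV. y $ i * du k i)"
    "((\<lambda>t. y \<bullet> (af (x + t *\<^sub>R axis k 1) *v y)) has_real_derivative dS k) (at 0)"
    by (rule pd_eqI, rule DERIV_pdI)
qed

lemma DERIV_fq: "((\<lambda>t. fq (bf (x + t *\<^sub>R axis k 1)) (af (x + t *\<^sub>R axis k 1)) y) has_real_derivative dq k) (at 0)"
proof (rule DERIV_axis_cong[OF open_D x, where f = "\<lambda>z. fq (bf z) (af z) y"])
  let ?z = "\<lambda>t. x + t *\<^sub>R axis k 1"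
  show "fq (bf z) (af z) y = sqrt (y \<bullet> (af z *v y) - (fb (bf z) y)\<^sup>2)" if "z \<in> D" for z
    by (rule finsleroid_data.q_eq[OF data[OF that]])
  have "((\<lambda>t. y \<bullet> (af (?z t) *v y) - (fb (bf (?z t)) y)\<^sup>2) has_real_derivative
     dS k - 2 * b * db k) (at 0)"
    by (rule derivative_eq_intros DERIV_yay DERIV_fb refl)+ simp
  from DERIV_chain2[OF DERIV_real_sqrt this] p.radicand_pos[OF y]
  have "((\<lambda>t. sqrt (y \<bullet> (af (?z t) *v y) - (fb (bf (?z t)) y)\<^sup>2)) has_real_derivative
     inverse q / 2 * (dS k - 2 * b * db k)) (at 0)" unfolding p.q_eq by simp
  then show "((\<lambda>t. sqrt (y \<bullet> (af (?z t) *v y) - (fb (bf (?z t)) y)\<^sup>2)) has_real_derivative dq k) (at 0)"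
    by (rule DERIV_cong) (use p.q_pos[OF y] in \<open>simp add: field_simps\<close>)
qed

lemma DERIV_fP: "((\<lambda>t. sqK_over_B (gf (x + t *\<^sub>R axis k 1)) (fb (bf (x + t *\<^sub>R axis k 1)) y)
      (fq (bf (x + t *\<^sub>R axis k 1)) (af (x + t *\<^sub>R axis k 1)) y)) has_real_derivative
    P * (\<gamma> / B * (q * db k - b * dq k) + (m - q * b / B) * dg $ k)) (at 0)"
  by (rule DERIV_cong[OF DERIV_sqK_over_B[OF DERIV_gf DERIV_fb DERIV_fq]])
    (use p.charge p.q_pos[OF y] in \<open>auto simp: fB_def\<close>)

lemma pd_K_square: "pd k (\<lambda>z. (fK (gf z) (bf z) (af z) y)\<^sup>2) x
   = 2 * P * (\<gamma> * q * db k + dS k / 2) + m * (P * B) * dg $ k"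
proof (rule pd_eqI_on_open[OF open_D x])
  show "(fK (gf z) (bf z) (af z) y)\<^sup>2 = sqK (gf z) (fb (bf z) y) (fq (bf z) (af z) y)" if "z \<in> D" for z
    by (rule fK_square) (use finsleroid_data.charge[OF data[OF that]] finsleroid_data.q_pos[OF data[OF that] y] in auto)
  have "q * dq k = dS k / 2 - b * db k" using p.q_pos[OF y] by simp
  then have r: "(b + \<gamma> * q) * db k + q * dq k = \<gamma> * q * db k + dS k / 2" by (simp add: algebra_simps)
  have K: "sqK \<gamma> b q = P * B" "P = sqK \<gamma> b q / (b\<^sup>2 + \<gamma> * q * b + q\<^sup>2)"
    using sqK_eq[OF p.charge p.q_pos[OF y]] by (simp_all add: fB_def sqK_over_B_def)
  show "((\<lambda>t. sqK (gf (x + t *\<^sub>R axis k 1)) (fb (bf (x + t *\<^sub>R axis k 1)) y)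
      (fq (bf (x + t *\<^sub>R axis k 1)) (af (x + t *\<^sub>R axis k 1)) y)) has_real_derivative
     2 * P * (\<gamma> * q * db k + dS k / 2) + m * (P * B) * dg $ k) (at 0)"
    unfolding r[symmetric] K(1)[symmetric] unfolding K(2)
    by (rule DERIV_cong[OF DERIV_sqK[OF DERIV_gf DERIV_fb DERIV_fq]])
      (use p.charge p.q_pos[OF y] in simp_all)
qed

lemma pd_lower: "pd k (\<lambda>z. finsleroid_data.lower (gf z) (bf z) (af z) y $ j) x
   = P * (\<gamma> / B * (q * db k - b * dq k) + (m - q * b / B) * dg $ k) * (\<gamma> * q * \<beta> $ j + (\<alpha> *v y) $ j)
     + P * ((dg $ k * q + \<gamma> * dq k) * \<beta> $ j + \<gamma> * q * d\<beta> k j + du k j)"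
proof (rule pd_eqI_on_open[OF open_D x])
  let ?z = "\<lambda>t. x + t *\<^sub>R axis k 1"
  show "finsleroid_data.lower (gf z) (bf z) (af z) y $ j
     = sqK_over_B (gf z) (fb (bf z) y) (fq (bf z) (af z) y) *
       (gf z * fq (bf z) (af z) y * bf z $ j + (af z *v y) $ j)" if "z \<in> D" for z
    by (simp add: finsleroid_data.lower_def[OF data[OF that]])
  have "((\<lambda>t. gf (?z t) * fq (bf (?z t)) (af (?z t)) y * bf (?z t) $ j
      + (af (?z t) *v y) $ j) has_real_derivative
      (dg $ k * q + \<gamma> * dq k) * \<beta> $ j + \<gamma> * q * d\<beta> k j + du k j) (at 0)"
    by (rule derivative_eq_intros DERIV_gf DERIV_fq DERIV_bf DERIV_ay refl)+ (simp add: algebra_simps)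
  from DERIV_mult[OF DERIV_fP this]
  show "((\<lambda>t. sqK_over_B (gf (?z t)) (fb (bf (?z t)) y) (fq (bf (?z t)) (af (?z t)) y) *
       (gf (?z t) * fq (bf (?z t)) (af (?z t)) y * bf (?z t) $ j + (af (?z t) *v y) $ j))
     has_real_derivative P * (\<gamma> / B * (q * db k - b * dq k) + (m - q * b / B) * dg $ k) * (\<gamma> * q * \<beta> $ j + (\<alpha> *v y) $ j)
     + P * ((dg $ k * q + \<gamma> * dq k) * \<beta> $ j + \<gamma> * q * d\<beta> k j + du k j)) (at 0)"
    by (rule DERIV_cong) (simp only: p.axis_shift_0 mult.commute[of P])
qed

lemma fundamental_tensor_field: "z \<in> D \<Longrightarrow> fundamental_tensor (K_field gf bf af) z y = finsleroid_data.metric (gf z) (bf z) (af z) y"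
  by (rule finsleroid_data.fundamental_tensor_eq[OF data _ y]) (simp_all add: K_field_def fun_eq_iff)

lemma DERIV_fundamental_tensor:
  "((\<lambda>t. fundamental_tensor (K_field gf bf af) (x + t *\<^sub>R axis k 1) y $ i $ j) has_real_derivative
     pd k (\<lambda>z. fundamental_tensor (K_field gf bf af) z y $ i $ j) x) (at 0)"
proof -
  let ?q = "\<lambda>z. fq (bf z) (af z) y" and ?b = "\<lambda>z. fb (bf z) y" and ?S = "\<lambda>z. y \<bullet> (af z *v y)"
    and ?u = "\<lambda>z. af z *v y"
  \<comment> \<open>\<open>B'\<close> is the quadratic form \<open>B\<close> as a function of \<open>x\<close>, and \<open>h\<close> a component of \<open>g\<^sub>i\<^sub>j\<close>; only its
    differentiability is needed, not the value of its derivative.\<close>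
  define B' where "B' = (\<lambda>z. (?b z)\<^sup>2 + gf z * ?q z * ?b z + (?q z)\<^sup>2)"
  define h where "h = (\<lambda>z. sqK_over_B (gf z) (?b z) (?q z) * (af z $ i $ j + gf z / (?q z * B' z) *
     ((gf z * ?q z * ?S z - ?b z * B' z) * bf z $ i * bf z $ j - ?b z * ?u z $ i * ?u z $ j
      + ?S z * (bf z $ i * ?u z $ j + ?u z $ i * bf z $ j))))"
  have d: "(\<lambda>t. f (x + t *\<^sub>R axis k 1)) differentiable (at 0)"
    if "((\<lambda>t. f (x + t *\<^sub>R axis k 1)) has_real_derivative d) (at 0)" for f :: "real^'n \<Rightarrow> real" and d
    using that by (auto simp: real_differentiable_def)
  have B': "(\<lambda>t. B' (x + t *\<^sub>R axis k 1)) differentiable (at 0)"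
    unfolding B'_def power2_eq_square
    by (intro differentiable_add differentiable_mult d[where f = gf, OF DERIV_gf]
       d[where f = ?b, OF DERIV_fb] d[where f = ?q, OF DERIV_fq])
  have "?q (x + 0 *\<^sub>R axis k 1) * B' (x + 0 *\<^sub>R axis k 1) \<noteq> 0"
    using p.q_pos[OF y] p.B_pos[OF y] by (simp add: fB_def B'_def)
  then have "(\<lambda>t. h (x + t *\<^sub>R axis k 1)) differentiable (at 0)"
    unfolding h_def
    by (intro differentiable_add differentiable_diff differentiable_mult differentiable_divide B'
       d[where f = gf, OF DERIV_gf] d[where f = ?b, OF DERIV_fb] d[where f = ?q, OF DERIV_fq] d[where f = ?S, OF DERIV_yay]
       d[where f = "\<lambda>z. ?u z $ i", OF DERIV_ay] d[where f = "\<lambda>z. ?u z $ j", OF DERIV_ay]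
       d[where f = "\<lambda>z. bf z $ i", OF DERIV_bf] d[where f = "\<lambda>z. bf z $ j", OF DERIV_bf]
       d[where f = "\<lambda>z. af z $ i $ j", OF DERIV_af]
       d[where f = "\<lambda>z. sqK_over_B (gf z) (?b z) (?q z)", OF DERIV_fP])
  then obtain r where r: "((\<lambda>t. h (x + t *\<^sub>R axis k 1)) has_real_derivative r) (at 0)"
    by (auto simp: real_differentiable_def)
  have "fundamental_tensor (K_field gf bf af) z y $ i $ j = h z" if "z \<in> D" for z
    unfolding fundamental_tensor_field[OF that] finsleroid_data.metric_def[OF data[OF that]]
    by (simp add: h_def B'_def fB_def)
  from DERIV_axis_cong[OF open_D x this r]
  show ?thesis by (rule DERIV_pdI[where f = "\<lambda>z. fundamental_tensor (K_field gf bf af) z y $ i $ j"])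
qed

text \<open>The Riemannian spray; the derivatives of \<open>b\<close>, \<open>S\<^sup>2\<close> and \<open>g\<close> in \<open>x\<close> along \<open>y\<close>; and \<open>y\<^sup>j y\<^sup>h \<nabla>\<^sub>j b\<^sub>h\<close>.\<close>

abbreviation "\<Gamma> \<equiv> (\<chi> i. \<Sum>n\<in>UNIV. \<Sum>l\<in>UNIV. christoffel af x i n l * y $ n * y $ l)"
abbreviation "Db \<equiv> \<Sum>k\<in>UNIV. y $ k * db k"
abbreviation "DS \<equiv> \<Sum>k\<in>UNIV. y $ k * dS k"
abbreviation "Dg \<equiv> \<Sum>k\<in>UNIV. y $ k * dg $ k"
abbreviation "s \<equiv> \<Sum>j\<in>UNIV. \<Sum>h\<in>UNIV. y $ j * y $ h * nabla af bf x j h"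

lemma lowered_riemannian_spray: "(\<alpha> *v \<Gamma>) $ j = (\<Sum>k\<in>UNIV. y $ k * du k j) - dS j / 2"
proof -
  have "\<Gamma> = matrix_inv \<alpha> *v (\<chi> j. (\<Sum>k\<in>UNIV. y $ k * du k j) - 1/2 * dS j)"
    using contracted_christoffel[where m = af and x = x and y = y, OF DERIV_af] by (simp add: vec_eq_iff)
  then show ?thesis by (simp add: p.mult_inv)
qed

lemma u_inner_riemannian_spray: "(\<alpha> *v y) \<bullet> \<Gamma> = DS / 2"
proof -
  have "(\<alpha> *v y) \<bullet> \<Gamma> = y \<bullet> (\<alpha> *v \<Gamma>)"
    by (rule trans[OF inner_commute p.self_adjoint])
  also have "\<dots> = (\<Sum>j\<in>UNIV. \<Sum>k\<in>UNIV. y $ j * (y $ k * du k j)) - DS / 2"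
    by (simp add: inner_vec_def lowered_riemannian_spray right_diff_distrib sum_subtractf sum_distrib_left sum_divide_distrib)
  also have "(\<Sum>j\<in>UNIV. \<Sum>k\<in>UNIV. y $ j * (y $ k * du k j)) = DS"
    unfolding dS_eq sum_distrib_left by (subst sum.swap) (simp add: mult.left_commute)
  finally show ?thesis by simp
qed

lemma Db_eq: "Db = (\<Sum>j\<in>UNIV. \<Sum>h\<in>UNIV. y $ j * y $ h * d\<beta> j h)"
  by (simp add: db_eq sum_distrib_left mult_ac)

lemma nabla_contracted: "\<beta> \<bullet> \<Gamma> = Db - s"
proof -
  have "\<beta> \<bullet> \<Gamma> = (\<Sum>k\<in>UNIV. \<Sum>j\<in>UNIV. \<Sum>h\<in>UNIV. y $ j * y $ h * (\<beta> $ k * christoffel af x k j h))"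
    by (simp add: inner_vec_def sum_distrib_left mult_ac)
  also have "\<dots> = (\<Sum>j\<in>UNIV. \<Sum>k\<in>UNIV. \<Sum>h\<in>UNIV. y $ j * y $ h * (\<beta> $ k * christoffel af x k j h))"
    by (rule sum.swap)
  also have "\<dots> = (\<Sum>j\<in>UNIV. \<Sum>h\<in>UNIV. \<Sum>k\<in>UNIV. y $ j * y $ h * (\<beta> $ k * christoffel af x k j h))"
    by (rule sum.cong[OF refl], rule sum.swap)
  also have "\<dots> = Db - s"
    unfolding Db_eq nabla_def by (simp add: right_diff_distrib sum_subtractf sum_distrib_left)
  finally show ?thesis .
qed

lemma christoffel_sym: "christoffel af x k i j = christoffel af x k j i"
proof -
  have "pd n (\<lambda>z. af z $ j $ i) x = pd n (\<lambda>z. af z $ i $ j) x" for n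
    by (rule pd_eqI_on_open[OF open_D x _ DERIV_af]) (rule finsleroid_data.sym[OF data])
  then show ?thesis by (simp add: christoffel_def add.commute)
qed

lemma curl_eq: "curl af bf x k l = d\<beta> k l - d\<beta> l k"
  unfolding curl_def nabla_def christoffel_sym[of _ l k] by simp

lemma curl_form_eq: "curl_form af bf x y $ j = db j - (\<Sum>k\<in>UNIV. y $ k * d\<beta> k j)"
  by (simp add: curl_form_def curl_eq db_eq right_diff_distrib sum_subtractf mult.commute)

lemma curl_vector_eq: "curl_vector af bf x y = matrix_inv \<alpha> *v curl_form af bf x y"
proof -
  have "curl_vector af bf x y $ i = (matrix_inv \<alpha> *v curl_form af bf x y) $ i" for i
    unfolding curl_vector_def curl_form_def matrix_vector_mult_def vec_lambda_beta sum_distrib_left sum_distrib_right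
    by (subst sum.swap) (simp add: mult.assoc)
  then show ?thesis by (simp add: vec_eq_iff)
qed

lemma inner_curl_vector:
  "(\<alpha> *v y) \<bullet> curl_vector af bf x y = 0"
  "\<beta> \<bullet> curl_vector af bf x y = raise \<alpha> \<beta> \<bullet> curl_form af bf x y"
proof -
  have *: "(\<alpha> *v z) \<bullet> curl_vector af bf x y = z \<bullet> curl_form af bf x y" for z
  proof -
    have "(\<alpha> *v z) \<bullet> curl_vector af bf x y = z \<bullet> (\<alpha> *v curl_vector af bf x y)"
      by (rule trans[OF inner_commute p.self_adjoint])
    then show ?thesis by (simp add: curl_vector_eq p.mult_inv)
  qed
  have "y \<bullet> curl_form af bf x y = Db - (\<Sum>j\<in>UNIV. \<Sum>k\<in>UNIV. y $ j * (y $ k * d\<beta> k j))"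
    by (simp add: inner_vec_def curl_form_eq right_diff_distrib sum_subtractf sum_distrib_left)
  also have "\<dots> = 0"
    unfolding Db_eq by (subst sum.swap) (simp add: mult_ac)
  finally show "(\<alpha> *v y) \<bullet> curl_vector af bf x y = 0" by (simp add: *)
  show "\<beta> \<bullet> curl_vector af bf x y = raise \<alpha> \<beta> \<bullet> curl_form af bf x y"
    using *[of "raise \<alpha> \<beta>"] by (simp add: p.lower_raise)
qed

lemma E_vector_eq:
  "E_vector gf bf af x y = (m * Dg) *\<^sub>R y + (q\<^sup>2 / (B * fnu \<gamma> \<beta> \<alpha> y) * Dg) *\<^sub>R p.cartan_dir y
     - (1/2 * m * (P * B)) *\<^sub>R (matrix_inv (p.metric y) *v dg)"
proof -
  have K: "K_field gf bf af x y = fK \<gamma> \<beta> \<alpha> y" by (simp add: K_field_def)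
  have Dg: "(\<Sum>h\<in>UNIV. pd h gf x * y $ h) = Dg" by (simp add: mult.commute)
  have "fK \<gamma> \<beta> \<alpha> y * (2 * q\<^sup>2 / B) * Dg * (1 / (2 * fK \<gamma> \<beta> \<alpha> y * fnu \<gamma> \<beta> \<alpha> y)) = q\<^sup>2 / (B * fnu \<gamma> \<beta> \<alpha> y) * Dg"
    using p.K_pos[OF y] by simp
  then have z: "fK \<gamma> \<beta> \<alpha> y * (2 * q\<^sup>2 / B) * Dg * (1 / (2 * fK \<gamma> \<beta> \<alpha> y * fnu \<gamma> \<beta> \<alpha> y) * p.cartan_dir y $ i)
     = q\<^sup>2 / (B * fnu \<gamma> \<beta> \<alpha> y) * Dg * p.cartan_dir y $ i" for i
    by (simp only: mult.assoc[symmetric])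
  have M: "(\<Sum>h\<in>UNIV. pd h gf x * matrix_inv (p.metric y) $ i $ h) = (matrix_inv (p.metric y) *v dg) $ i" for i
    by (simp add: matrix_vector_mult_def mult.commute)
  have XA: "XA_over_g gf bf af x y $ i = 1 / (2 * fK \<gamma> \<beta> \<alpha> y * fnu \<gamma> \<beta> \<alpha> y) * p.cartan_dir y $ i" for i
    by (simp add: p.XA_over_g_eq[where gf = gf and bf = bf and af = af and x = x, OF refl refl refl y])
  show ?thesis
    unfolding vec_eq_iff E_vector_def vec_lambda_beta Let_def K Dg XA z fundamental_tensor_field[OF x] M
      fM_eq[OF p.charge p.q_pos[OF y]] p.K_square[OF y]
    using p.K_pos[OF y] by simp
qed

lemma spray_formula:
  "spray (K_field gf bf af) x y =
     (\<gamma> / fnu \<gamma> \<beta> \<alpha> y * (s + \<gamma> * q * (raise \<alpha> \<beta> \<bullet> curl_form af bf x y))) *\<^sub>R fv \<beta> \<alpha> y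
     - (\<gamma> * q) *\<^sub>R curl_vector af bf x y + E_vector gf bf af x y + \<Gamma>" (is "_ = ?V")
proof -
  let ?F = "K_field gf bf af"
  let ?Dq = "(DS / 2 - b * Db) / q"
  define c where "c = (\<chi> j. (\<Sum>k\<in>UNIV. y $ k * pd k (\<lambda>z. (fundamental_tensor ?F z y *v y) $ j) x)
          - 1/2 * pd j (\<lambda>z. y \<bullet> (fundamental_tensor ?F z y *v y)) x)"
  have ft: "fundamental_tensor ?F z y *v y = finsleroid_data.lower (gf z) (bf z) (af z) y" if "z \<in> D" for z
    unfolding fundamental_tensor_field[OF that] by (rule finsleroid_data.metric_mult_y[OF data[OF that] y])
  have spray: "spray ?F x y = matrix_inv (p.metric y) *v c"
    using contracted_christoffel[where m = "\<lambda>z. fundamental_tensor ?F z y" and x = x and y = y, OF DERIV_fundamental_tensor]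
    unfolding spray_def c_def by (simp add: vec_eq_iff fundamental_tensor_field[OF x])
  let ?T = "\<lambda>j. \<gamma> * q * \<beta> $ j + (\<alpha> *v y) $ j"
  let ?X = "P * (\<gamma> / B * (q * Db - b * ?Dq) + (m - q * b / B) * Dg)"
  have Dq: "(\<Sum>k\<in>UNIV. y $ k * dq k) = ?Dq"
  proof -
    have "(\<Sum>k\<in>UNIV. y $ k * dq k) = (\<Sum>k\<in>UNIV. 1 / (2 * q) * (y $ k * dS k) - b / q * (y $ k * db k))"
      by (intro sum.cong refl) (simp add: right_diff_distrib diff_divide_distrib mult_ac)
    also have "\<dots> = ?Dq"
      unfolding sum_subtractf sum_distrib_left[symmetric] by (simp add: diff_divide_distrib)
    finally show ?thesis .
  qed
  \<comment> \<open>Two ring identities: the derivative of \<open>y\<^sub>j\<close> as a linear combination of the derivatives of the data,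
    and the result of contracting it with \<open>y\<close>. The terms with \<open>\<partial>\<^sub>j b\<close> cancel in the second one.\<close>
  have split: "yk * (P' * (w * (q' * dbk - b' * dqk) + v * dgk) * T + P' * ((dgk * q' + \<gamma>' * dqk) * \<beta>' + \<gamma>' * q' * d\<beta>k + duk))
    = P' * w * q' * T * (yk * dbk) + (P' * \<gamma>' * \<beta>' - P' * w * b' * T) * (yk * dqk)
      + (P' * v * T + P' * q' * \<beta>') * (yk * dgk) + P' * \<gamma>' * q' * (yk * d\<beta>k) + P' * (yk * duk)"
    for yk P' w q' dbk b' dqk v dgk T \<gamma>' \<beta>' d\<beta>k duk :: real
    by algebra
  have collect: "P' * w * q' * T * Db' + (P' * \<gamma>' * \<beta>' - P' * w * b' * T) * Dq'
      + (P' * v * T + P' * q' * \<beta>') * Dg' + P' * \<gamma>' * q' * (dbj - f) + P' * (a + dSj / 2)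
      - 1/2 * (2 * P' * (\<gamma>' * q' * dbj + dSj / 2) + n * dgj)
    = P' * (w * (q' * Db' - b' * Dq') + v * Dg') * T + P' * ((Dg' * q' + \<gamma>' * Dq') * \<beta>' - \<gamma>' * q' * f + a) - 1/2 * n * dgj"
    for P' w q' T Db' \<gamma>' \<beta>' b' Dq' v Dg' dbj f a dSj n dgj :: real
    by (simp add: algebra_simps)
  have c: "c $ j = ?X * ?T j + P * ((Dg * q + \<gamma> * ?Dq) * \<beta> $ j - \<gamma> * q * curl_form af bf x y $ j + (\<alpha> *v \<Gamma>) $ j)
      - 1/2 * (m * (P * B)) * dg $ j" for j
  proof -
    have 1: "pd k (\<lambda>z. (fundamental_tensor ?F z y *v y) $ j) x
      = pd k (\<lambda>z. finsleroid_data.lower (gf z) (bf z) (af z) y $ j) x" for k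
      by (rule pd_eq_on_open[OF open_D x]) (simp add: ft)
    have 2: "pd j (\<lambda>z. y \<bullet> (fundamental_tensor ?F z y *v y)) x = pd j (\<lambda>z. (fK (gf z) (bf z) (af z) y)\<^sup>2) x"
      by (rule pd_eq_on_open[OF open_D x]) (simp add: ft finsleroid_data.inner_lower[OF data y])
    have "(\<Sum>k\<in>UNIV. y $ k * pd k (\<lambda>z. (fundamental_tensor ?F z y *v y) $ j) x)
      = (\<Sum>k\<in>UNIV. P * (\<gamma> / B) * q * ?T j * (y $ k * db k) + (P * \<gamma> * \<beta> $ j - P * (\<gamma> / B) * b * ?T j) * (y $ k * dq k)
          + (P * (m - q * b / B) * ?T j + P * q * \<beta> $ j) * (y $ k * dg $ k)
          + P * \<gamma> * q * (y $ k * d\<beta> k j) + P * (y $ k * du k j))"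
      unfolding 1 pd_lower by (intro sum.cong refl) (rule split)
    also have "\<dots> = P * (\<gamma> / B) * q * ?T j * Db + (P * \<gamma> * \<beta> $ j - P * (\<gamma> / B) * b * ?T j) * ?Dq
          + (P * (m - q * b / B) * ?T j + P * q * \<beta> $ j) * Dg
          + P * \<gamma> * q * (\<Sum>k\<in>UNIV. y $ k * d\<beta> k j) + P * (\<Sum>k\<in>UNIV. y $ k * du k j)"
      unfolding sum.distrib sum_distrib_left[symmetric] Dq ..
    also have "(\<Sum>k\<in>UNIV. y $ k * d\<beta> k j) = db j - curl_form af bf x y $ j"
      by (simp add: curl_form_eq)
    also have "(\<Sum>k\<in>UNIV. y $ k * du k j) = (\<alpha> *v \<Gamma>) $ j + dS j / 2"
      by (simp add: lowered_riemannian_spray)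
    finally show ?thesis
      unfolding c_def vec_lambda_beta 2 pd_K_square by (simp only: collect)
  qed
  have f: "\<alpha> *v curl_vector af bf x y = curl_form af bf x y"
    by (simp add: curl_vector_eq p.mult_inv)
  have V: "p.metric y *v ?V = c"
    unfolding E_vector_eq p.lowered_spray[OF y nabla_contracted u_inner_riemannian_spray inner_curl_vector refl]
    by (simp add: vec_eq_iff c f)
  show ?thesis using p.metric_inv_mult[OF y, of ?V] unfolding spray V .
qed

end
end

section \<open>Finsleroid-regular spaces\<close>

lemma smooth_on_imp_differentiable_on: "smooth_on D f \<Longrightarrow> f differentiable_on D"
  unfolding smooth_on_def using Ck_on.simps(2)[of 0 D f] by blast

lemma finsleroid_regular_space_chart:
  fixes \<A> :: "('m::{t2_space, second_countable_topology}, 'n::finite) chart set"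
  assumes space: "finsleroid_regular_space \<A> am bm gm" and \<phi>: "\<phi> \<in> \<A>"
  shows "finsleroid_field (chart_image \<phi>) (local_rep \<phi> gm) (bm \<phi>) (am \<phi>)"
proof (rule finsleroid_field.intro)
  have a: "riemannian_metric \<A> am" and b: "smooth_one_form \<A> bm" and g: "smooth_scalar_field \<A> gm"
    and \<A>: "smooth_atlas \<A>"
    using space by (auto simp: finsleroid_regular_space_def)
  show "open (chart_image \<phi>)" using \<A> \<phi> by (auto simp: smooth_atlas_def is_chart_def)
  show "local_rep \<phi> gm differentiable_on chart_image \<phi>"
    using g \<phi> by (auto simp: smooth_scalar_field_def intro: smooth_on_imp_differentiable_on)
  show "(\<lambda>z. bm \<phi> z $ i) differentiable_on chart_image \<phi>" for i
    using b \<phi> by (auto simp: smooth_one_form_def intro: smooth_on_imp_differentiable_on)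
  show "(\<lambda>z. am \<phi> z $ i $ j) differentiable_on chart_image \<phi>" for i j
    using a \<phi> by (auto simp: riemannian_metric_def intro: smooth_on_imp_differentiable_on)
  fix z assume z: "z \<in> chart_image \<phi>"
  show "finsleroid_data (local_rep \<phi> gm z) (bm \<phi> z) (am \<phi> z)"
  proof
    show "am \<phi> z $ i $ j = am \<phi> z $ j $ i" for i j
      using a \<phi> z by (auto simp: riemannian_metric_def)
    have "y \<bullet> (am \<phi> z *v y) = (\<Sum>i\<in>UNIV. \<Sum>j\<in>UNIV. am \<phi> z $ i $ j * y $ i * y $ j)" for y
      by (simp add: inner_vec_def matrix_vector_mult_def sum_distrib_left mult_ac)
    moreover have "(\<Sum>i\<in>UNIV. \<Sum>j\<in>UNIV. am \<phi> z $ i $ j * y $ i * y $ j) > 0" if "y \<noteq> 0" for y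
      using a \<phi> z that by (auto simp: riemannian_metric_def)
    ultimately show "0 < y \<bullet> (am \<phi> z *v y)" if "y \<noteq> 0" for y
      using that by simp
    show "form_norm (am \<phi> z) (bm \<phi> z) < 1"
      using space \<phi> z by (auto simp: finsleroid_regular_space_def)
    have "- 2 < gm (chart_inv \<phi> z)" "gm (chart_inv \<phi> z) < 2"
      using space by (auto simp: finsleroid_regular_space_def)
    then show "\<bar>local_rep \<phi> gm z\<bar> < 2" by (simp add: local_rep_def abs_less_iff)
  qed
qed

theorem theorem1:
  fixes \<A> :: "('m::{t2_space, second_countable_topology}, 'n::finite) chart set"
    and am :: "('m, 'n) chart \<Rightarrow> real^'n \<Rightarrow> real^'n^'n"
    and bm :: "('m, 'n) chart \<Rightarrow> real^'n \<Rightarrow> real^'n"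
    and gm :: "'m \<Rightarrow> real"
    and p :: 'm and y :: "real^'n" and i :: 'n
  assumes "finsleroid_regular_space \<A> am bm gm"
    and "\<phi> \<in> \<A>" and "p \<in> chart_dom \<phi>" and "y \<noteq> 0"
  shows "let x = coords \<phi> p; a = am \<phi>; b = bm \<phi>; g = local_rep \<phi> gm;
             q = fq (b x) (a x) y; \<nu> = fnu (g x) (b x) (a x) y
         in spray (K_field g b a) x y $ i =
              g x / \<nu> *
                ((\<Sum>j\<in>UNIV. \<Sum>h\<in>UNIV. y $ j * y $ h * nabla a b x j h)
                 + g x * q * (\<Sum>j\<in>UNIV. raise (a x) (b x) $ j * curl_form a b x y $ j))
                * fv (b x) (a x) y $ i
              - g x * q * curl_vector a b x y $ i
              + E_vector g b a x y $ i
              + (\<Sum>n\<in>UNIV. \<Sum>m\<in>UNIV. christoffel a x i n m * y $ n * y $ m)"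
proof -
  interpret finsleroid_field "chart_image \<phi>" "local_rep \<phi> gm" "bm \<phi>" "am \<phi>"
    by (rule finsleroid_regular_space_chart[OF assms(1,2)])
  have "coords \<phi> p \<in> chart_image \<phi>" using assms(3) by (simp add: chart_image_def)
  note formula = spray_formula[OF this assms(4)]
  show ?thesis
    unfolding Let_def formula vector_add_component vector_minus_component vector_scaleR_component
      real_scaleR_def inner_vec_def inner_real_def vec_lambda_beta ..
qed

end
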